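(* Assume the setting given in the context, and suppose the following hold. (A1) (a) $\Pi$ is a proper prior on $\mathbb{R}^p$ with a bounded and continuous p.d.f. $\pi$ with $\pi(\boldsymbol\beta_0)>0$; (b) $\int \|\boldsymbol\beta\|^2\pi(\boldsymbol\beta)\,d\boldsymbol\beta<\infty$. (A2) There is $M>0$ with $\|\mathbf X_i\|\le M$ for all $i$. (A3) (a) The first coordinate of each $\mathbf X_i$ is identically $1$ and, after appropriate centering of the other coordinates (subtracting a suitable constant from each of them), there is $\epsilon_0>0$ such that $\liminf_{n\to\infty}\frac1n\sum_{i=1}^n I_{(\mathbf X_i\in D)}>0$ for every $D\subset\mathbb{R}^p$ of the form $\{1\}\times U_2\times\cdots\times U_p$ where, for some $j$, $U_j$ is either $(\epsilon_0,\infty)$ or $(-\infty,-\epsilon_0)$ and, for each $k\ne j$, $U_k$ is either $(0,\infty)$ or $(-\infty,0)$; (b) there is $C>0$ such that for all sufficiently small $\Delta>0$, $P(0<Z_i<\Delta)>C\Delta$ and $P(-\Delta<Z_i<0)>C\Delta$ for all $i$. (A4) $\limsup_{m\to\infty}\frac1m\sum_{i=1}^m E|Z_i|<\infty$ and $\sum_{i=1}^\infty \frac{E Z_i^2}{i^2}<\infty$. (A5) (a) $\{p_i(\mathbf X_i^T\boldsymbol\beta_0): i\ge1\}$ is uniformly bounded away from $\infty$; (b) for some $C,\eta>0$ and all $\boldsymbol\beta$ in some small enough neighborhood of $\boldsymbol\beta_0$, $|p_i(\mathbf X_i^T\boldsymbol\beta)-p_i(\mathbf X_i^T\boldsymbol\beta_0)|\le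 C|\mathbf X_i^T\boldsymbol\beta-\mathbf X_i^T\boldsymbol\beta_0|^\eta$ for all $i$. Then $$\sup_{B}\left|\Pi_n\left(\sqrt n(\boldsymbol\beta-\boldsymbol\beta_0)\in B\right)-\Phi\left(B,\ \sqrt n(\boldsymbol\beta_n^M-\boldsymbol\beta_0),\ V^{-1}\right)\right|\to 0\quad\text{in probability }[P],$$ where the supremum is over Borel sets $B\subset\mathbb{R}^p$.
   Context: Fix $\tau\in(0,1)$. $Y_1,Y_2,\dots$ are independent (not necessarily identically distributed) real random variables, $Y_i$ having p.d.f. $p_i$; $P=\prod_{i\ge1}p_i$ is the infinite product probability and $E$ the expectation under it. $\mathbf X_1,\mathbf X_2,\dots\in\mathbb{R}^p$ are non-random covariate vectors. The true $\tau$-th quantile of $Y_i$ is $\mathbf X_i^T\boldsymbol\beta_0$ for a fixed $\boldsymbol\beta_0\in\mathbb{R}^p$; with $Z_i:=Y_i-\mathbf X_i^T\boldsymbol\beta_0$, $P(Z_i\le0)=\tau$. $I_{(\cdot)}$ denotes an indicator. Let $\rho_\tau(u)=u(\tau-I_{(u\le0)})$. The (possibly misspecified) asymmetric Laplace likelihood is $f^{(n)}_{\boldsymbol\beta}=\prod_{i=1}^n f_{i\boldsymbol\beta}(Y_i)$, where $f_{i\boldsymbol\beta}(y)=\tau(1-\tau)\exp\{-\rho_\tau(y-\mathbf X_i^T\boldsymbol\beta)\}$, $y\in\mathbb{R}$. The posterior for a prior $\Pi$ with p.d.f. $\pi$ on $\mathbb{R}^p$ is $$\Pi_n(\boldsymbol\beta\in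 B)=\frac{\int_B f^{(n)}_{\boldsymbol\beta}\pi(\boldsymbol\beta)\,d\boldsymbol\beta}{\int_{\mathbb{R}^p} f^{(n)}_{\boldsymbol\beta}\pi(\boldsymbol\beta)\,d\boldsymbol\beta}.$$ The classical quantile regression estimator is $\boldsymbol\beta_n^M\in\arg\min_{\boldsymbol\beta}\sum_{i=1}^n\rho_\tau(Y_i-\mathbf X_i^T\boldsymbol\beta)$. $V=\lim_{n\to\infty}\frac1n\sum_{i=1}^n p_i(\mathbf X_i^T\boldsymbol\beta_0)\mathbf X_i\mathbf X_i^T$; this limit is assumed to exist and to be invertible. $\Phi(B,\boldsymbol\mu,\boldsymbol\Sigma)$ is the probability of $B$ under the multivariate normal distribution with mean $\boldsymbol\mu$ and covariance matrix $\boldsymbol\Sigma$. *)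

theory Defs
  imports "HOL-Probability.Probability"
begin

definition check_loss :: "real \<Rightarrow> real \<Rightarrow> real" where
  "check_loss \<tau> u = u * (\<tau> - indicator {..0} u)"

definition ald_density :: "real \<Rightarrow> real ^ 'p \<Rightarrow> real ^ 'p \<Rightarrow> real \<Rightarrow> real" where
  "ald_density \<tau> x \<beta> y = \<tau> * (1 - \<tau>) * exp (- check_loss \<tau> (y - x \<bullet> \<beta>))"

text \<open>
  Data sequences are indexed from 1; the value at index 0 is never used. The argument
  \<open>y\<close> is a realisation of the whole response sequence.
\<close>

definition ald_likelihood ::
    "real \<Rightarrow> (nat \<Rightarrow> real ^ 'p) \<Rightarrow> nat \<Rightarrow> (nat \<Rightarrow> real) \<Rightarrow> real ^ 'p \<Rightarrow> real" where
  "ald_likelihood \<tau> X n y \<beta> = (\<Prod>i=1..n. ald_density \<tau> (X i) \<beta> (y i))"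

definition posterior ::
    "real \<Rightarrow> (nat \<Rightarrow> real ^ 'p) \<Rightarrow> (real ^ 'p \<Rightarrow> real) \<Rightarrow> nat \<Rightarrow> (nat \<Rightarrow> real) \<Rightarrow> (real ^ 'p) set \<Rightarrow> real"
  where
  "posterior \<tau> X prior n y B =
     (LINT \<beta>:B|lborel. ald_likelihood \<tau> X n y \<beta> * prior \<beta>) /
     (LINT \<beta>|lborel. ald_likelihood \<tau> X n y \<beta> * prior \<beta>)"

definition outer_square :: "real ^ 'p \<Rightarrow> real ^ 'p ^ 'p" where
  "outer_square x = (\<chi> j k. x $ j * x $ k)"

text \<open>The density of the normal law, for a positive definite covariance matrix \<open>S\<close>.\<close>

definition mvn_density :: "real ^ 'p \<Rightarrow> real ^ 'p ^ 'p \<Rightarrow> real ^ 'p \<Rightarrow> real" where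
  "mvn_density \<mu> S x =
     exp (- ((x - \<mu>) \<bullet> (matrix_inv S *v (x - \<mu>))) / 2) / sqrt ((2 * pi) ^ CARD('p) * det S)"

definition mvn_prob :: "(real ^ 'p) set \<Rightarrow> real ^ 'p \<Rightarrow> real ^ 'p ^ 'p \<Rightarrow> real" where
  "mvn_prob B \<mu> S = measure (density lborel (\<lambda>x. ennreal (mvn_density \<mu> S x))) B"

text \<open>
  The sets \<open>{1} \<times> U\<^sub>2 \<times> \<dots> \<times> U\<^sub>p\<close> in which one factor is a half-line beyond \<open>\<epsilon>\<close> in
  absolute value and the others are open half-lines starting at 0. The index type is
  unordered, so the first coordinate is a designated index \<open>k1\<close>.
\<close>

definition spread_sets :: "'p \<Rightarrow> real \<Rightarrow> (real ^ 'p) set set" where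
  "spread_sets k1 \<epsilon> =
     {{x. \<forall>k. x $ k \<in> U k} | U. U k1 = {1} \<and>
        (\<exists>j. j \<noteq> k1 \<and> U j \<in> {{\<epsilon><..}, {..<-\<epsilon>}} \<and>
             (\<forall>k. k \<noteq> k1 \<and> k \<noteq> j \<longrightarrow> U k \<in> {{0<..}, {..<0}}))}"

text \<open>
  Measurability is part of the definition because \<open>measure M\<close> is 0 on sets that are not
  measurable.
\<close>

definition tendsto_in_prob :: "'a measure \<Rightarrow> (nat \<Rightarrow> 'a \<Rightarrow> real) \<Rightarrow> real \<Rightarrow> bool" where
  "tendsto_in_prob M T c \<longleftrightarrow>
     (\<forall>n. T n \<in> borel_measurable M) \<and>
     (\<forall>\<epsilon>>0. (\<lambda>n. measure M {\<omega> \<in> space M. \<bar>T n \<omega> - c\<bar> > \<epsilon>}) \<longlonglongrightarrow> 0)"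

end

theory Submission
  imports Defs
begin

text \<open>
  In the local parameter \<open>h = \<surd>n (\<beta> - \<beta>\<^sub>0)\<close> the log posterior is, up to a constant, minus the convex
  function \<open>D\<^sub>n h = \<Sum>i\<le>n. \<rho>\<^sub>\<tau> (Z\<^sub>i - X\<^sub>i\<^sup>T h / \<surd>n) - \<rho>\<^sub>\<tau> (Z\<^sub>i)\<close>. Knight's identity writes \<open>D\<^sub>n h = - W\<^sub>n \<bullet> h + R\<^sub>n h\<close>
  with a centred linear term, which is tight, and a nonnegative remainder whose mean tends to
  \<open>q h = h \<bullet> V h / 2\<close> and whose variance vanishes. Convexity upgrades the resulting pointwise
  convergence \<open>R\<^sub>n h \<rightarrow> q h\<close> to uniform closeness on balls, controlled by finitely many points. On the event
  where \<open>W\<^sub>n\<close> is bounded and \<open>R\<^sub>n\<close> is uniformly close to \<open>q\<close>, the minimiser of \<open>D\<^sub>n\<close> is near \<open>V\<^sup>-\<^sup>1 W\<^sub>n\<close>, and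
  convexity makes \<open>D\<^sub>n\<close> grow at least linearly away from it, so dominated convergence compares the
  posterior density with the normal density in \<open>L\<^sup>1\<close>. By Scheffe's identity the supremum over Borel sets is half of
  that \<open>L\<^sup>1\<close> distance.
\<close>

section \<open>Uniform closeness of convex functions\<close>

text \<open>Dominated convergence is a pointwise tool, whereas the loss here converges only in
  probability. The analysis is therefore deterministic: \<open>posterior_L1_tendsto\<close> treats
  arbitrary sequences of convex functions, a contradiction argument turns it into thresholds fixed
  before the function is known (\<open>posterior_L1_uniform\<close>), and probability enters only
  through the event on which the thresholds are met. The same order of choice lets a union bound
  over a finite set of \<open>h\<close> replace uniform control of a random function. Convexity also
  stands in for a separate consistency proof: exceeding the central value on one small sphere forces
  linear growth outside it, so posterior mass far from the centre is exponentially small and one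
  integrable majorant serves all large indices. The normal law is centred at the rescaled estimator
  instead of \<open>matrix_inv V *v W\<close>; the growth bound confines every minimiser, so the two
  centres differ by o(1) in probability. Writing the supremum as an integral also settles its
  measurability, which is not evident for a supremum over uncountably many sets.\<close>

text \<open>A cube is the hull of its finitely many vertices, so a convex function on it is bounded
  above by finitely many of its values.\<close>

lemma small_polytope_neighbourhood:
  fixes x :: "'a::euclidean_space"
  assumes "r > 0"
  obtains S where "finite S" "x \<in> interior (convex hull S)" "convex hull S \<subseteq> ball x r"
proof -
  \<comment> \<open>The coordinate deviations, \<open>DIM('a)\<close> of them and each at most
    \<open>d\<close>, add up to \<open>r / 2\<close> in the l1 bound below.\<close>
  define d where "d = r / (2 * DIM('a))"
  have d: "d > 0" using assms by (simp add: d_def)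
  let ?s = "(\<Sum>i\<in>Basis. d *\<^sub>R i)::'a"
  obtain S where S: "finite S" "cbox (x - ?s) (x + ?s) = convex hull S"
    using cube_convex_hull[OF d] by blast
  have si: "?s \<bullet> i = d" if "i \<in> Basis" for i
    using that by (simp add: inner_sum_left inner_Basis if_distrib cong: if_cong)
  have "x \<in> box (x - ?s) (x + ?s)" using d si by (auto simp: mem_box inner_diff_left inner_add_left)
  then have "x \<in> interior (convex hull S)" using S(2) interior_cbox by metis
  moreover have "convex hull S \<subseteq> ball x r"
  proof
    fix y assume "y \<in> convex hull S"
    then have y: "y \<in> cbox (x - ?s) (x + ?s)" using S by simp
    have "norm (y - x) \<le> (\<Sum>i\<in>Basis. \<bar>(y - x) \<bullet> i\<bar>)" by (rule norm_le_l1)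
    also have "\<dots> \<le> (\<Sum>i\<in>(Basis::'a set). d)"
    proof (rule sum_mono)
      fix i :: 'a assume "i \<in> Basis"
      then show "\<bar>(y - x) \<bullet> i\<bar> \<le> d"
        using y si[of i] by (force simp: mem_box inner_diff_left inner_add_left)
    qed
    also have "\<dots> = r / 2" by (simp add: d_def)
    also have "\<dots> < r" using assms by simp
    finally show "y \<in> ball x r" by (simp add: dist_norm norm_minus_commute)
  qed
  ultimately show ?thesis using that S(1) by blast
qed

text \<open>\<open>H\<close> and \<open>d\<close> depend on \<open>q\<close>, \<open>R\<close> and
  \<open>e\<close> alone, so they can be fixed before a random \<open>g\<close> is seen. A convex
  function is controlled from above by the vertices of small cells, and from below by that upper
  bound together with the cell centres.\<close>

lemma convex_near_on_finite_imp_near_on_ball: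
  fixes q :: "'a::euclidean_space \<Rightarrow> real"
  assumes q: "continuous_on UNIV q" and e: "e > 0"
  shows "\<exists>H d. finite H \<and> d > 0 \<and> (\<forall>g. convex_on UNIV g \<and> (\<forall>h\<in>H. \<bar>g h - q h\<bar> \<le> d) \<longrightarrow>
    (\<forall>h. norm h \<le> R \<longrightarrow> \<bar>g h - q h\<bar> \<le> e))"
proof -
  \<comment> \<open>The margin 3 leaves room for the points used below: a reflected point has norm
    at most \<open>R + 1\<close>, and the vertices of a cell containing such a point have norm at
    most \<open>R + 3\<close>.\<close>
  have "uniformly_continuous_on (cball 0 (R + 3)) q"
    by (rule compact_uniformly_continuous) (auto intro: continuous_on_subset[OF q])
  then obtain s0 where s0: "s0 > 0"
    "\<And>x y. x \<in> cball 0 (R+3) \<Longrightarrow> y \<in> cball 0 (R+3) \<Longrightarrow> dist y x < s0 \<Longrightarrow> dist (q y) (q x) < e / 8"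
    unfolding uniformly_continuous_on_def using e by (metis divide_pos_pos zero_less_numeral)
  define s where "s = min s0 1"
  have s: "s > 0" "s \<le> 1" "s \<le> s0" using s0(1) by (auto simp: s_def)
  have uc: "\<bar>q y - q x\<bar> < e / 8" if "norm x \<le> R + 3" "norm y \<le> R + 3" "dist y x < s" for x y
    using s0(2)[of x y] that s(3) by (auto simp: dist_real_def)
  have "\<exists>S. finite S \<and> x \<in> interior (convex hull S) \<and> convex hull S \<subseteq> ball x (s/2)" for x :: 'a
    using small_polytope_neighbourhood[of "s/2" x] s(1) by (metis half_gt_zero)
  then obtain S where S: "\<And>x::'a. finite (S x)" "\<And>x. x \<in> interior (convex hull S x)"
    "\<And>x. convex hull S x \<subseteq> ball x (s/2)" by metis
  obtain T where T: "T \<subseteq> cball 0 (R+1)" "finite T" "cball 0 (R+1) \<subseteq> (\<Union>x\<in>T. interior (convex hull S x))"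
    using compactE_image[OF compact_cball, of "cball 0 (R+1)" "\<lambda>x. interior (convex hull S x)"] S(2)
    by (smt (verit, best) UN_I open_interior subsetI)
  define H where "H = T \<union> (\<Union>x\<in>T. S x)"
  have "finite H" using T S by (auto simp: H_def)
  moreover have "e / 8 > 0" using e by simp
  moreover have "\<bar>g h - q h\<bar> \<le> e"
    if g: "convex_on UNIV g" and gH: "\<And>h. h \<in> H \<Longrightarrow> \<bar>g h - q h\<bar> \<le> e / 8" and h: "norm h \<le> R" for g h
  proof -
    have cell: "\<exists>x\<in>T. h \<in> convex hull S x \<and> dist h x < s / 2" if h1: "norm h \<le> R + 1" for h
    proof -
      obtain x where x: "x \<in> T" "h \<in> interior (convex hull S x)" using h1 T(3) by (auto simp: subset_iff)
      then have "h \<in> convex hull S x" using interior_subset by blast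
      moreover have "dist h x < s/2" using S(3)[of x] calculation by (auto simp: dist_commute)
      ultimately show ?thesis using x by blast
    qed
    \<comment> \<open>On a polytope a convex function is at most its largest vertex value. Each
      vertex costs \<open>e / 8\<close> for \<open>g\<close> against \<open>q\<close> and
      \<open>e / 8\<close> for the oscillation of \<open>q\<close>. The radius is
      \<open>R + 1\<close> because the bound is also applied to the reflected point.\<close>
    have upper: "g h \<le> q h + e / 4" if h1: "norm h \<le> R + 1" for h
    proof -
      obtain x where x: "x \<in> T" "h \<in> convex hull S x" "dist h x < s / 2" using cell[OF h1] by blast
      have "\<forall>v\<in>S x. g v \<le> q h + e / 4"
      proof
        fix v assume v: "v \<in> S x"
        have "dist v x < s / 2" using S(3)[of x] v hull_inc[of v "S x" convex] by (auto simp: dist_commute)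
        then have "dist v h < s" using x(3) dist_triangle_half_r[of x v s h] by (simp add: dist_commute)
        moreover have "norm v \<le> R + 3" using calculation h1 s norm_triangle_sub[of v h] by (simp add: dist_norm)
        ultimately have "\<bar>q v - q h\<bar> < e / 8" using uc[of h v] h1 by simp
        moreover have "\<bar>g v - q v\<bar> \<le> e / 8" using gH x v by (auto simp: H_def)
        ultimately show "g v \<le> q h + e / 4" by linarith
      qed
      then show ?thesis
        using convex_on_convex_hull_bound[of "S x" g "q h + e/4"] x(2) convex_on_subset[OF g] by blast
    qed
    \<comment> \<open>Convexity bounds \<open>g\<close> from below by reflecting \<open>h\<close> in a nearby point of \<open>H\<close>.\<close>
    obtain x where x: "x \<in> T" "dist h x < s / 2" using cell[of h] h by auto
    define h' where "h' = 2 *\<^sub>R x - h"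
    have hh': "h' - h = 2 *\<^sub>R (x - h)" by (simp add: h'_def algebra_simps scaleR_2)
    then have d: "dist h' h < s" using x(2) by (simp add: dist_norm norm_minus_commute)
    have n: "norm h' \<le> R + 1" using d h s norm_triangle_sub[of h' h] by (simp add: dist_norm)
    have "\<bar>q h' - q h\<bar> < e / 8" using uc[of h h'] d n h by simp
    moreover have "\<bar>q x - q h\<bar> < e / 8"
      using uc[of h x] x s h T(1) by (force simp: dist_commute)
    moreover have "\<bar>g x - q x\<bar> \<le> e / 8" using gH x by (auto simp: H_def)
    moreover have "g h' \<le> q h' + e / 4" using upper n by blast
    moreover have "g x \<le> g h / 2 + g h' / 2"
      using convex_onD[OF g, of "1/2" h h'] by (simp add: h'_def algebra_simps)
    moreover have "g h \<le> q h + e / 4" using upper h by simp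
    \<comment> \<open>The lower bound is \<open>g h >= 2 * g x - g h' >= 2 * (q h - e / 4) - (q h +
      3 * e / 8) = q h - 7 * e / 8\<close>.\<close>
    ultimately show ?thesis by linarith
  qed
  ultimately show ?thesis by (intro exI[of _ H] exI[of _ "e / 8"]) blast
qed

section \<open>Gaussian integrals\<close>

lemma nn_integral_lborel_prod_Basis:
  fixes F :: "real \<Rightarrow> ennreal"
  assumes [measurable]: "F \<in> borel_measurable borel"
  shows "(\<integral>\<^sup>+ x. (\<Prod>b\<in>Basis. F (x \<bullet> b)) \<partial>(lborel::'a::euclidean_space measure)) = (\<integral>\<^sup>+ t. F t \<partial>lborel) ^ DIM('a)"
proof -
  interpret product_sigma_finite "\<lambda>b::'a. (lborel :: real measure)"
    by unfold_locales
  have "(\<integral>\<^sup>+ x. (\<Prod>b\<in>Basis. F (x \<bullet> b)) \<partial>(lborel::'a measure))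
      = (\<integral>\<^sup>+ f. (\<Prod>b\<in>Basis. F ((\<Sum>b\<in>Basis. f b *\<^sub>R b) \<bullet> b)) \<partial>(\<Pi>\<^sub>M b\<in>(Basis::'a set). lborel))"
    by (subst lborel_eq, subst nn_integral_distr) auto
  also have "\<dots> = (\<integral>\<^sup>+ f. (\<Prod>b\<in>Basis. F (f b)) \<partial>(\<Pi>\<^sub>M b\<in>(Basis::'a set). lborel))"
    by (intro nn_integral_cong prod.cong) (auto simp: inner_sum_left inner_Basis if_distrib cong: if_cong)
  also have "\<dots> = (\<integral>\<^sup>+ t. F t \<partial>lborel) ^ DIM('a)"
    by (subst product_nn_integral_prod) auto
  finally show ?thesis .
qed

lemma integrable_exp_neg_abs:
  fixes c :: real assumes "c > 0"
  shows "integrable lborel (\<lambda>x. exp (- c * \<bar>x\<bar>))"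
proof -
  have "has_bochner_integral lborel (\<lambda>x. indicator {0..} x *\<^sub>R exp (- \<bar>x::real\<bar>)) 1"
  proof (rule has_bochner_integral_nn_integral)
    have "(\<integral>\<^sup>+ x. ennreal (indicator {0..} x *\<^sub>R exp (- \<bar>x::real\<bar>)) \<partial>lborel)
        = (\<integral>\<^sup>+ x. ennreal (x ^ 0 * exp (- x)) * indicator {0..} x \<partial>lborel)"
      by (intro nn_integral_cong) (auto simp: indicator_def)
    then show "(\<integral>\<^sup>+ x. ennreal (indicator {0..} x *\<^sub>R exp (- \<bar>x::real\<bar>)) \<partial>lborel) = ennreal 1"
      by (simp only: nn_intergal_power_times_exp_Ici) simp
  qed auto
  then have "integrable lborel (\<lambda>x. exp (- \<bar>x::real\<bar>))"
    using has_bochner_integral_even_function[of "\<lambda>x. exp (- \<bar>x::real\<bar>)" 1] by (auto simp: has_bochner_integral_iff)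
  from lborel_integrable_real_affine[OF this, of c 0] show ?thesis
    using assms by (simp add: abs_mult)
qed

text \<open>The l1 norm is at most \<open>DIM('a)\<close> times the Euclidean norm, so a product of
  one-dimensional exponentials of rate \<open>c / DIM('a)\<close> is a majorant. The result supplies
  the dominating function for the posterior densities.\<close>

lemma integrable_exp_neg_norm:
  fixes c :: real assumes "c > 0"
  shows "integrable lborel (\<lambda>x::'a::euclidean_space. exp (- c * norm x))"
proof (rule Bochner_Integration.integrable_bound)
  let ?c = "c / DIM('a)"
  let ?F = "\<lambda>t::real. ennreal (exp (- ?c * \<bar>t\<bar>))"
  have c: "?c > 0" using assms by simp
  have "(\<integral>\<^sup>+ x. (\<Prod>b\<in>Basis. ?F (x \<bullet> b)) \<partial>(lborel::'a measure)) = (\<integral>\<^sup>+ t. ?F t \<partial>lborel) ^ DIM('a)"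
    by (rule nn_integral_lborel_prod_Basis) simp
  also have "\<dots> < \<infinity>" using integrable_exp_neg_abs[OF c]
    by (simp add: nn_integral_eq_integral power_less_top_ennreal)
  finally show "integrable lborel (\<lambda>x::'a. \<Prod>b\<in>Basis. exp (- ?c * \<bar>x \<bullet> b\<bar>))"
    by (intro integrableI_nonneg) (auto simp: prod_nonneg prod_ennreal)
  show "AE x in lborel. norm (exp (- c * norm (x::'a))) \<le> norm (\<Prod>b\<in>Basis. exp (- ?c * \<bar>x \<bullet> b\<bar>))"
  proof (rule AE_I2)
    fix x :: 'a
    have "(\<Sum>b\<in>Basis. \<bar>x \<bullet> b\<bar>) \<le> (\<Sum>b\<in>(Basis::'a set). norm x)" by (intro sum_mono Basis_le_norm)
    then have "?c * (\<Sum>b\<in>Basis. \<bar>x \<bullet> b\<bar>) \<le> c * norm x"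
      using assms by (simp add: field_simps)
    then show "norm (exp (- c * norm x)) \<le> norm (\<Prod>b\<in>Basis. exp (- ?c * \<bar>x \<bullet> b\<bar>))"
      by (simp add: exp_sum[symmetric] sum_distrib_left sum_negf)
  qed
qed simp

lemma nn_integral_exp_neg_norm_sq:
  "(\<integral>\<^sup>+ x. ennreal (exp (- (x \<bullet> x) / 2)) \<partial>(lborel::'a::euclidean_space measure)) = ennreal (sqrt ((2 * pi) ^ DIM('a)))"
proof -
  have std: "exp (- t\<^sup>2 / 2) = sqrt (2 * pi) * std_normal_density t" for t :: real
    by (simp add: std_normal_density_def)
  have "(\<integral>\<^sup>+ t. ennreal (exp (- t\<^sup>2 / 2)) \<partial>lborel) = ennreal (sqrt (2 * pi))"
    unfolding std by (subst nn_integral_eq_integral) (auto simp: normal_density_nonneg)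
  moreover have "ennreal (exp (- (x \<bullet> x) / 2)) = (\<Prod>b\<in>Basis. ennreal (exp (- (x \<bullet> b)\<^sup>2 / 2)))" for x :: 'a
    by (simp add: prod_ennreal exp_sum[symmetric] euclidean_inner[of x x] power2_eq_square sum_divide_distrib sum_negf)
  ultimately show ?thesis
    by (simp add: nn_integral_lborel_prod_Basis[where F="\<lambda>t. ennreal (exp (- (t\<^sup>2 / 2)))"] ennreal_power real_sqrt_power power_mult_distrib real_sqrt_mult)
qed

section \<open>Linear changes of variables\<close>

text \<open>Integrate over coordinate \<open>i\<close> first: with the other coordinates fixed, the
  shear is a translation of that single coordinate.\<close>

lemma nn_integral_lborel_shear:
  fixes F :: "'a::euclidean_space \<Rightarrow> ennreal"
  assumes [measurable]: "F \<in> borel_measurable borel" and i: "i \<in> Basis" and j: "j \<in> Basis" "i \<noteq> j"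
  shows "(\<integral>\<^sup>+ x. F (x + (c * (x \<bullet> j)) *\<^sub>R i) \<partial>lborel) = (\<integral>\<^sup>+ x. F x \<partial>lborel)"
proof -
  interpret product_sigma_finite "\<lambda>b::'a. (lborel :: real measure)"
    by unfold_locales
  let ?I = "Basis - {i}"
  let ?s = "\<lambda>f. \<Sum>b\<in>Basis. f b *\<^sub>R b"
  have fubini: "(\<integral>\<^sup>+ x. G x \<partial>lborel) = (\<integral>\<^sup>+ f. (\<integral>\<^sup>+ y. G (?s (f(i := y))) \<partial>lborel) \<partial>(\<Pi>\<^sub>M b\<in>?I. lborel))"
    if [measurable]: "G \<in> borel_measurable borel" for G :: "'a \<Rightarrow> ennreal"
  proof -
    have "(\<integral>\<^sup>+ x. G x \<partial>lborel) = (\<integral>\<^sup>+ f. G (?s f) \<partial>(\<Pi>\<^sub>M b\<in>insert i ?I. lborel))"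
      using i by (subst lborel_eq, subst nn_integral_distr) (auto simp: insert_absorb)
    also have "\<dots> = (\<integral>\<^sup>+ f. (\<integral>\<^sup>+ y. G (?s (f(i := y))) \<partial>lborel) \<partial>(\<Pi>\<^sub>M b\<in>?I. lborel))"
    proof (rule product_nn_integral_insert)
      show "(\<lambda>f. G (?s f)) \<in> borel_measurable (\<Pi>\<^sub>M b\<in>insert i ?I. lborel)"
        using i by (simp add: insert_absorb)
    qed auto
    finally show ?thesis .
  qed
  have Split: "?s g = g i *\<^sub>R i + (\<Sum>b\<in>?I. g b *\<^sub>R b)" for g
    using i by (simp add: sum.remove)
  have "(\<integral>\<^sup>+ x. F (x + (c * (x \<bullet> j)) *\<^sub>R i) \<partial>lborel)
      = (\<integral>\<^sup>+ f. (\<integral>\<^sup>+ y. F (?s (f(i := y)) + (c * (?s (f(i := y)) \<bullet> j)) *\<^sub>R i) \<partial>lborel) \<partial>(\<Pi>\<^sub>M b\<in>?I. lborel))"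
    by (rule fubini) simp
  also have "\<dots> = (\<integral>\<^sup>+ f. (\<integral>\<^sup>+ y. F (?s (f(i := y))) \<partial>lborel) \<partial>(\<Pi>\<^sub>M b\<in>?I. lborel))"
  proof (rule nn_integral_cong)
    fix f :: "'a \<Rightarrow> real"
    have meas: "(\<lambda>y. F (?s (f(i := y)))) \<in> borel_measurable borel"
      unfolding Split by simp
    have "?s (f(i := y)) \<bullet> j = f j" for y
      using j inner_sum_left_Basis[of j "f(i := y)"] by (simp del: fun_upd_apply add: fun_upd_other[OF j(2)[symmetric]])
    then have "?s (f(i := y)) + (c * (?s (f(i := y)) \<bullet> j)) *\<^sub>R i = ?s (f(i := c * f j + 1 * y))" for y
      by (simp add: Split algebra_simps)
    then show "(\<integral>\<^sup>+ y. F (?s (f(i := y)) + (c * (?s (f(i := y)) \<bullet> j)) *\<^sub>R i) \<partial>lborel)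
        = (\<integral>\<^sup>+ y. F (?s (f(i := y))) \<partial>lborel)"
      using nn_integral_real_affine[of "\<lambda>y. F (?s (f(i := y)))" 1 "c * f j"] by (simp add: meas del: fun_upd_apply)
  qed
  also have "\<dots> = (\<integral>\<^sup>+ x. F x \<partial>lborel)" by (rule fubini[symmetric]) simp
  finally show ?thesis .
qed

lemma measurable_matrix_vector_mult [measurable]: "(\<lambda>x. (A::real^'n^'m) *v x) \<in> borel_measurable borel"
  by (intro borel_measurable_continuous_onI linear_continuous_on linear_conv_bounded_linear[THEN iffD1] matrix_vector_mul_linear)

text \<open>
  The linear change of variables in \<open>HOL-Analysis\<close> needs a well-ordered index type.
\<close>

lemma nn_integral_lborel_matrix:
  fixes A :: "real^'n^'n"
  assumes "F \<in> borel_measurable borel" "det A \<noteq> 0"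
  shows "ennreal \<bar>det A\<bar> * (\<integral>\<^sup>+ x. F (A *v x) \<partial>lborel) = (\<integral>\<^sup>+ x. F x \<partial>lborel)"
proof -
  \<comment> \<open>\<open>P\<close> quantifies over all \<open>F\<close> because, for a product,
    the hypothesis on \<open>B\<close> is applied to the composition of \<open>F\<close> with
    \<open>A\<close>.\<close>
  define P where "P A \<longleftrightarrow> (det A \<noteq> 0 \<longrightarrow> (\<forall>F \<in> borel_measurable borel.
      ennreal \<bar>det A\<bar> * (\<integral>\<^sup>+ x. F (A *v x) \<partial>lborel) = (\<integral>\<^sup>+ x. F x \<partial>lborel)))" for A :: "real^'n^'n"
  have "P A"
  proof (induction A rule: induct_matrix_elementary)
    case (1 A B)
    show ?case unfolding P_def
    proof (intro impI ballI)
      fix F :: "real^'n \<Rightarrow> ennreal" assume F[measurable]: "F \<in> borel_measurable borel" and d: "det (A ** B) \<noteq> 0"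
      have dA: "det A \<noteq> 0" "det B \<noteq> 0" using d by (auto simp: det_mul)
      have "ennreal \<bar>det (A ** B)\<bar> * (\<integral>\<^sup>+ x. F ((A ** B) *v x) \<partial>lborel)
          = ennreal \<bar>det A\<bar> * (ennreal \<bar>det B\<bar> * (\<integral>\<^sup>+ x. F (A *v (B *v x)) \<partial>lborel))"
        by (simp add: det_mul abs_mult ennreal_mult mult.assoc matrix_vector_mul_assoc)
      also have "\<dots> = ennreal \<bar>det A\<bar> * (\<integral>\<^sup>+ x. F (A *v x) \<partial>lborel)"
        using 1(2)[unfolded P_def, rule_format, of "\<lambda>x. F (A *v x)"] dA by simp
      also have "\<dots> = (\<integral>\<^sup>+ x. F x \<partial>lborel)" using 1(1) dA by (simp add: P_def)
      finally show "ennreal \<bar>det (A ** B)\<bar> * (\<integral>\<^sup>+ x. F ((A ** B) *v x) \<partial>lborel) = (\<integral>\<^sup>+ x. F x \<partial>lborel)" .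
    qed
  next
    case (2 A i)
    \<comment> \<open>A zero row makes the determinant vanish, so the claim holds vacuously.\<close>
    then show ?case using det_zero_row(1)[of i A] by (simp add: P_def row_def vec_eq_iff)
  next
    case (3 A)
    have det: "det A = (\<Prod>i\<in>UNIV. A$i$i)" using 3 by (rule det_diagonal)
    show ?case unfolding P_def
    proof (intro impI ballI)
      fix F :: "real^'n \<Rightarrow> ennreal" assume F[measurable]: "F \<in> borel_measurable borel" and d: "det A \<noteq> 0"
      \<comment> \<open>The scaling theorem for \<open>lborel\<close> takes factors indexed by basis
        vectors; \<open>c\<close> reads the diagonal entry off the basis vector.\<close>
      define c where "c b = (\<Sum>i\<in>UNIV. A $ i $ i * b $ i)" for b :: "real^'n"
      have c: "c (axis k 1) = A $ k $ k" for k by (simp add: c_def axis_def if_distrib cong: if_cong)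
      have B: "(Basis :: (real^'n) set) = (\<lambda>k. axis k 1) ` UNIV" by (auto simp: Basis_vec_def)
      have inj: "inj (\<lambda>k::'n. axis k (1::real))" by (auto simp: inj_on_def axis_eq_axis)
      have nz: "c j \<noteq> 0" if "j \<in> Basis" for j
        using that d by (auto simp: B c det)
      have T: "(\<Sum>j\<in>Basis. (c j * (x \<bullet> j)) *\<^sub>R j) = A *v x" for x
      proof -
        have "A *v x = (\<chi> i. A $ i $ i * x $ i)"
        proof (subst vec_eq_iff, intro allI)
          fix i
          have "(\<Sum>j\<in>UNIV. A $ i $ j * x $ j) = (\<Sum>j\<in>UNIV. if j = i then A $ i $ i * x $ i else 0)"
            using 3 by (intro sum.cong) auto
          then show "(A *v x) $ i = (\<chi> i. A $ i $ i * x $ i) $ i"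
            by (simp add: matrix_vector_mult_def)
        qed
        moreover have "(\<Sum>j\<in>Basis. (c j * (x \<bullet> j)) *\<^sub>R j) = (\<chi> i. A $ i $ i * x $ i)"
          unfolding B by (subst sum.reindex[OF inj]) (simp add: vec_eq_iff c inner_axis, simp add: axis_def if_distrib cong: if_cong)
        ultimately show ?thesis by simp
      qed
      have p: "(\<Prod>j\<in>Basis. \<bar>c j\<bar>) = \<bar>det A\<bar>"
        unfolding B by (subst prod.reindex[OF inj]) (simp add: c det abs_prod)
      have "lborel = density (distr lborel borel ((*v) A)) (\<lambda>_. ennreal \<bar>det A\<bar>)"
        using lborel_affine_euclidean[of c 0, OF nz] p by (simp add: T)
      then have "(\<integral>\<^sup>+ x. F x \<partial>lborel) = (\<integral>\<^sup>+ x. F x \<partial>density (distr lborel borel ((*v) A)) (\<lambda>_. ennreal \<bar>det A\<bar>))"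
        by simp
      also have "\<dots> = ennreal \<bar>det A\<bar> * (\<integral>\<^sup>+ x. F (A *v x) \<partial>lborel)"
        by (simp add: nn_integral_density nn_integral_distr nn_integral_cmult)
      finally show "ennreal \<bar>det A\<bar> * (\<integral>\<^sup>+ x. F (A *v x) \<partial>lborel) = (\<integral>\<^sup>+ x. F x \<partial>lborel)" ..
    qed
  next
    case (4 m n)
    let ?t = "Transposition.transpose m n"
    let ?A = "(\<chi> i j. mat 1 $ i $ ?t j) :: real^'n^'n"
    have tp: "?t permutes UNIV" by (rule permutes_swap_id) auto
    have "det ?A = of_int (sign ?t) * det (mat 1 :: real^'n^'n)" by (rule det_permute_columns[OF tp])
    then have det: "\<bar>det ?A\<bar> = 1" by (simp add: abs_mult sign_def)
    have A: "?A *v x = (\<chi> i. x $ ?t i)" for x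
    proof (subst vec_eq_iff, intro allI)
      fix i
      have "(\<Sum>j\<in>UNIV. ?A $ i $ j * x $ j) = (\<Sum>j\<in>UNIV. if j = ?t i then x $ ?t i else 0)"
        by (intro sum.cong) (auto simp: mat_def)
      then show "(?A *v x) $ i = (\<chi> i. x $ ?t i) $ i"
        by (simp add: matrix_vector_mult_def)
    qed
    have B: "(Basis :: (real^'n) set) = (\<lambda>k. axis k 1) ` UNIV" by (auto simp: Basis_vec_def)
    have inj: "inj (\<lambda>k::'n. axis k (1::real))" by (auto simp: inj_on_def axis_eq_axis)
    have prodB: "(\<Prod>b\<in>Basis. v \<bullet> b) = (\<Prod>k\<in>UNIV. v $ k)" for v :: "real^'n"
      unfolding B by (subst prod.reindex[OF inj]) (simp add: inner_axis)
    \<comment> \<open>Swapping two coordinates maps boxes to boxes with the same side lengths, and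
      \<open>lborel\<close> is determined by its values on boxes.\<close>
    have "lborel = distr lborel borel ((*v) ?A)"
    proof (rule lborel_eqI)
      fix l u :: "real^'n" assume le: "\<And>b. b \<in> Basis \<Longrightarrow> l \<bullet> b \<le> u \<bullet> b"
      have le': "l $ k \<le> u $ k" for k using le[of "axis k 1"] by (simp add: B inner_axis)
      have pre: "(*v) ?A -` box l u = box (\<chi> i. l $ ?t i) (\<chi> i. u $ ?t i)"
      proof (rule set_eqI)
        fix x :: "real^'n"
        have "(\<forall>i. l $ i < x $ ?t i \<and> x $ ?t i < u $ i) \<longleftrightarrow> (\<forall>i. l $ ?t i < x $ i \<and> x $ i < u $ ?t i)"
          by (metis transpose_involutory)
        then show "x \<in> (*v) ?A -` box l u \<longleftrightarrow> x \<in> box (\<chi> i. l $ ?t i) (\<chi> i. u $ ?t i)"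
          by (simp only: vimage_eq A mem_box_cart vec_lambda_beta)
      qed
      have "emeasure (distr lborel borel ((*v) ?A)) (box l u)
          = emeasure lborel (box (\<chi> i. l $ ?t i) (\<chi> i. u $ ?t i))"
        by (subst emeasure_distr) (auto simp: pre)
      also have "\<dots> = (\<Prod>b\<in>Basis. ((\<chi> i. u $ ?t i) - (\<chi> i. l $ ?t i)) \<bullet> b)"
        by (subst emeasure_lborel_box) (auto simp: B inner_axis le')
      also have "\<dots> = (\<Prod>k\<in>UNIV. (u - l) $ ?t k)" by (simp add: prodB)
      also have "\<dots> = (\<Prod>k\<in>UNIV. (u - l) $ k)"
        using prod.permute[OF tp, of "\<lambda>k. (u - l) $ k"] by (simp add: o_def)
      finally show "emeasure (distr lborel borel ((*v) ?A)) (box l u) = (\<Prod>b\<in>Basis. (u - l) \<bullet> b)"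
        by (simp only: prodB)
    qed simp
    note lb = this
    show ?case unfolding P_def
    proof (intro impI ballI)
      fix F :: "real^'n \<Rightarrow> ennreal" assume F[measurable]: "F \<in> borel_measurable borel"
      have "(\<integral>\<^sup>+ x. F x \<partial>lborel) = (\<integral>\<^sup>+ x. F x \<partial>distr lborel borel ((*v) ?A))"
        by (subst lb) (rule refl)
      also have "\<dots> = (\<integral>\<^sup>+ x. F (?A *v x) \<partial>lborel)"
        by (rule nn_integral_distr) auto
      finally show "ennreal \<bar>det ?A\<bar> * (\<integral>\<^sup>+ x. F (?A *v x) \<partial>lborel) = (\<integral>\<^sup>+ x. F x \<partial>lborel)"
        by (simp only: det ennreal_1 mult_1)
    qed
  next
    case (5 m n c)
    let ?A = "(\<chi> i j. if i = m \<and> j = n then c else of_bool (i = j)) :: real^'n^'n"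
    have "?A = (\<chi> k. if k = m then row m (mat 1) + c *s row n (mat 1) else row k (mat 1))"
      using 5 by (auto simp: vec_eq_iff row_def mat_def)
    then have "det ?A = 1" using det_row_operation[OF 5, of "mat 1" c] by simp
    moreover have "?A *v x = x + (c * (x \<bullet> axis n 1)) *\<^sub>R axis m 1" for x
    proof (subst vec_eq_iff, intro allI)
      fix i
      have "(\<Sum>j\<in>UNIV. ?A $ i $ j * x $ j) = (\<Sum>j\<in>UNIV. (if j = i then x $ i else 0) + (if j = n then (if i = m then c * x $ n else 0) else 0))"
        using 5 by (intro sum.cong) auto
      then show "(?A *v x) $ i = (x + (c * (x \<bullet> axis n 1)) *\<^sub>R axis m 1) $ i"
        by (simp add: matrix_vector_mult_def sum.distrib inner_axis, simp add: axis_def)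
    qed
    ultimately show ?case unfolding P_def
      using nn_integral_lborel_shear[of _ "axis m 1 :: real^'n" "axis n 1" c] 5 by (simp add: axis_eq_axis)
  qed
  then show ?thesis using assms by (simp add: P_def)
qed

section \<open>Positive definite quadratic forms\<close>

text \<open>Gram-Schmidt for the inner product \<open>x \<bullet> (V *v y)\<close>, by induction on
  the set of indices already treated.\<close>

lemma ex_orthonormal_wrt_pos_def:
  fixes V :: "real^'n^'n"
  assumes sym: "\<And>x y. x \<bullet> (V *v y) = y \<bullet> (V *v x)"
    and pos: "\<And>x. x \<noteq> 0 \<Longrightarrow> x \<bullet> (V *v x) > 0"
  shows "\<exists>a :: 'n \<Rightarrow> real^'n. \<forall>i\<in>S. \<forall>j\<in>S. a i \<bullet> (V *v a j) = (if i = j then 1 else 0)"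
proof -
  have "finite S" by simp
  then show ?thesis
  proof (induction S rule: finite_induct)
    case (insert k S)
    then obtain a where a: "\<And>i j. i \<in> S \<Longrightarrow> j \<in> S \<Longrightarrow> a i \<bullet> (V *v a j) = (if i = j then 1 else 0)" by blast
    \<comment> \<open>The index \<open>k\<close> is still free, so fewer vectors than the dimension
      have been used and some \<open>w\<close> lies outside their span.\<close>
    have "S \<noteq> UNIV" using insert by auto
    then have "card S < CARD('n)" by (intro psubset_card_mono) auto
    then have "dim (span (a ` S)) < DIM(real^'n)"
      using dim_le_card'[of "a ` S"] card_image_le[of S a] insert by simp
    then have "span (a ` S) \<noteq> UNIV" by (metis dim_UNIV less_irrefl)
    then obtain w where w: "w \<notin> span (a ` S)" by blast
    define u where "u = w - (\<Sum>j\<in>S. (w \<bullet> (V *v a j)) *\<^sub>R a j)"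
    have "(\<Sum>j\<in>S. (w \<bullet> (V *v a j)) *\<^sub>R a j) \<in> span (a ` S)"
      by (intro span_sum span_scale span_base) auto
    then have "u \<noteq> 0" using w by (auto simp: u_def)
    then have up: "u \<bullet> (V *v u) > 0" by (rule pos)
    have uo: "u \<bullet> (V *v a i) = 0" if "i \<in> S" for i
    proof -
      have "(\<Sum>j\<in>S. (w \<bullet> (V *v a j)) * (a j \<bullet> (V *v a i))) = (\<Sum>j\<in>S. if j = i then w \<bullet> (V *v a i) else 0)"
        using that by (intro sum.cong) (auto simp: a)
      then show ?thesis using that insert by (simp add: u_def inner_diff_left inner_sum_left)
    qed
    define s where "s = sqrt (u \<bullet> (V *v u))"
    have s: "s * s = u \<bullet> (V *v u)" "s \<noteq> 0" using up by (auto simp: s_def)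
    define a' where "a' = a(k := u /\<^sub>R s)"
    have k: "a' k = u /\<^sub>R s" and S: "\<And>i. i \<in> S \<Longrightarrow> a' i = a i"
      using insert(2) by (auto simp: a'_def)
    have "a' k \<bullet> (V *v a' k) = 1"
      unfolding k using s up by (simp add: matrix_vector_mult_scaleR field_simps)
    moreover have ki: "a' k \<bullet> (V *v a' i) = 0" if "i \<in> S" for i
      unfolding k using uo[OF that] S[OF that] by simp
    moreover have "a' i \<bullet> (V *v a' k) = 0" if "i \<in> S" for i
      using ki[OF that] sym[of "a' i" "a' k"] by simp
    moreover have "a' i \<bullet> (V *v a' j) = (if i = j then 1 else 0)" if "i \<in> S" "j \<in> S" for i j
      using a that S by simp
    ultimately have "\<forall>i\<in>insert k S. \<forall>j\<in>insert k S. a' i \<bullet> (V *v a' j) = (if i = j then 1 else 0)"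
      using insert(2) by auto
    then show ?case by blast
  qed simp
qed

text \<open>Let \<open>A\<close> have the \<open>V\<close>-orthonormal vectors as columns, so that
  \<open>transpose A ** V ** A = mat 1\<close>. Substituting \<open>A *v y\<close> reduces the form
  to \<open>y \<bullet> y\<close>, and the determinant of this identity yields both
  \<open>det V > 0\<close> and the Jacobian \<open>1 / sqrt (det V)\<close>.\<close>

lemma nn_integral_exp_neg_quadratic:
  fixes V :: "real^'n^'n"
  assumes sym: "\<And>x y. x \<bullet> (V *v y) = y \<bullet> (V *v x)"
    and pos: "\<And>x. x \<noteq> 0 \<Longrightarrow> x \<bullet> (V *v x) > 0"
  shows "det V > 0"
    "(\<integral>\<^sup>+ x. ennreal (exp (- (x \<bullet> (V *v x)) / 2)) \<partial>lborel) = ennreal (sqrt ((2 * pi) ^ CARD('n) / det V))"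
proof -
  have "\<exists>a :: 'n \<Rightarrow> real^'n. \<forall>i\<in>UNIV. \<forall>j\<in>UNIV. a i \<bullet> (V *v a j) = (if i = j then 1 else 0)"
    by (rule ex_orthonormal_wrt_pos_def; (rule sym | erule pos))
  then obtain a :: "'n \<Rightarrow> real^'n" where "\<forall>i\<in>UNIV. \<forall>j\<in>UNIV. a i \<bullet> (V *v a j) = (if i = j then 1 else 0)" ..
  then have a: "a i \<bullet> (V *v a j) = (if i = j then 1 else 0)" for i j by simp
  define A where "A = (\<chi> i j. a j $ i)"
  have Ay: "A *v y = (\<Sum>j\<in>UNIV. y $ j *\<^sub>R a j)" for y
    by (simp add: vec_eq_iff A_def matrix_vector_mult_def mult.commute)
  have I: "transpose A ** V ** A = mat 1"
  proof -
    have "(transpose A ** V ** A) $ i $ j = a i \<bullet> (V *v a j)" for i j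
    proof -
      have "(transpose A ** V ** A) $ i $ j = (transpose A ** (V ** A)) $ i $ j" by (simp add: matrix_mul_assoc)
      also have "\<dots> = a i \<bullet> (V *v a j)"
        by (simp add: matrix_matrix_mult_def transpose_def A_def inner_vec_def matrix_vector_mult_def)
      finally show ?thesis .
    qed
    then show ?thesis by (simp add: vec_eq_iff mat_def a)
  qed
  have "det (transpose A ** V ** A) = 1" using I by simp
  then have d: "det A * det A * det V = 1" by (simp add: det_mul mult_ac)
  then have dA: "det A \<noteq> 0" by auto
  then have "det A * det A > 0" by (metis not_real_square_gt_zero)
  then show dV: "det V > 0" using d by (metis zero_less_mult_pos zero_less_one)
  have q: "(A *v y) \<bullet> (V *v (A *v y)) = y \<bullet> y" for y
  proof -
    have "V *v (A *v y) = (\<Sum>j\<in>UNIV. y $ j *\<^sub>R (V *v a j))"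
      unfolding Ay by (simp add: linear_sum[OF matrix_vector_mul_linear] matrix_vector_mult_scaleR)
    then have "(A *v y) \<bullet> (V *v (A *v y)) = (\<Sum>i\<in>UNIV. y $ i * (\<Sum>j\<in>UNIV. y $ j * (if j = i then 1 else 0)))"
      unfolding Ay by (simp only: inner_sum_left inner_sum_right inner_scaleR_left inner_scaleR_right a)
    then show ?thesis by (simp add: inner_vec_def if_distrib cong: if_cong)
  qed
  have abs: "\<bar>det A\<bar> = 1 / sqrt (det V)"
  proof -
    have "sqrt (det A * det A * det V) = 1" using d by simp
    then have "\<bar>det A\<bar> * sqrt (det V) = 1" by (simp add: real_sqrt_mult)
    then show ?thesis using dV by (simp add: field_simps)
  qed
  have "(\<integral>\<^sup>+ x. ennreal (exp (- (x \<bullet> (V *v x)) / 2)) \<partial>lborel)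
      = ennreal \<bar>det A\<bar> * (\<integral>\<^sup>+ x. ennreal (exp (- (x \<bullet> x) / 2)) \<partial>(lborel :: (real^'n) measure))"
    by (subst nn_integral_lborel_matrix[OF _ dA, symmetric]) (auto simp: q)
  also have "\<dots> = ennreal (sqrt ((2 * pi) ^ CARD('n) / det V))"
    by (subst nn_integral_exp_neg_norm_sq) (simp add: abs real_sqrt_divide ennreal_mult[symmetric] dV less_imp_le)
  finally show "(\<integral>\<^sup>+ x. ennreal (exp (- (x \<bullet> (V *v x)) / 2)) \<partial>lborel) = ennreal (sqrt ((2 * pi) ^ CARD('n) / det V))" .
qed

section \<open>The normal density in terms of its precision matrix\<close>

lemma matrix_inv_cancel:
  fixes V :: "real^'n^'n"
  assumes "invertible V"
  shows "matrix_inv (matrix_inv V) = V" "det (matrix_inv V) = 1 / det V" "V *v (matrix_inv V *v x) = x" "matrix_inv V *v (V *v x) = x"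
proof -
  have *: "A ** matrix_inv A = mat 1 \<and> matrix_inv A ** A = mat 1" if "invertible A" for A :: "real^'n^'n"
    using that unfolding matrix_inv_def invertible_def by (rule someI_ex)
  then have 1: "V ** matrix_inv V = mat 1" "matrix_inv V ** V = mat 1" using assms by auto
  then have "invertible (matrix_inv V)" by (auto simp: invertible_def)
  then have "matrix_inv V ** matrix_inv (matrix_inv V) = mat 1" using * by blast
  then show "matrix_inv (matrix_inv V) = V"
  proof -
    assume r: "matrix_inv V ** matrix_inv (matrix_inv V) = mat 1"
    have "matrix_inv (matrix_inv V) = (V ** matrix_inv V) ** matrix_inv (matrix_inv V)" by (simp add: 1)
    also have "\<dots> = V ** (matrix_inv V ** matrix_inv (matrix_inv V))" by (simp only: matrix_mul_assoc)
    finally show ?thesis by (simp add: r)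
  qed
  have "det V * det (matrix_inv V) = det (mat 1 :: real^'n^'n)" using 1 by (simp only: det_mul[symmetric])
  then have d: "det V * det (matrix_inv V) = 1" by simp
  then have "det V \<noteq> 0" by auto
  with d show "det (matrix_inv V) = 1 / det V" by (simp add: field_simps)
  show "V *v (matrix_inv V *v x) = x" "matrix_inv V *v (V *v x) = x" using 1 by (simp_all add: matrix_vector_mul_assoc)
qed

lemma mvn_density_inv_eq:
  assumes "invertible V"
  shows "mvn_density \<mu> (matrix_inv V) x
    = exp (- ((x - \<mu>) \<bullet> (V *v (x - \<mu>))) / 2) / sqrt ((2 * pi) ^ CARD('n) / det (V::real^'n^'n))"
  by (simp add: mvn_density_def matrix_inv_cancel[OF assms])

lemma measurable_quadratic [measurable]:
  "(\<lambda>x. x \<bullet> ((V::real^'n^'n) *v x)) \<in> borel_measurable borel"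
  by measurable

lemma
  fixes V :: "real^'n^'n"
  assumes inv: "invertible V" and sym: "\<And>x y. x \<bullet> (V *v y) = y \<bullet> (V *v x)"
    and pos: "\<And>x. x \<noteq> 0 \<Longrightarrow> x \<bullet> (V *v x) > 0"
  shows mvn_density_measurable: "mvn_density \<mu> (matrix_inv V) \<in> borel_measurable borel"
    and mvn_density_integrable: "integrable lborel (mvn_density \<mu> (matrix_inv V))"
    and mvn_density_integral: "(\<integral>x. mvn_density \<mu> (matrix_inv V) x \<partial>lborel) = 1"
    and mvn_prob_eq: "B \<in> sets borel \<Longrightarrow> mvn_prob B \<mu> (matrix_inv V) = (LINT x:B|lborel. mvn_density \<mu> (matrix_inv V) x)"
proof -
  note eq = mvn_density_inv_eq[OF inv, of \<mu>]
  show meas[measurable]: "mvn_density \<mu> (matrix_inv V) \<in> borel_measurable borel"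
    unfolding eq[abs_def] by measurable
  have dV: "det V > 0" using nn_integral_exp_neg_quadratic(1)[of V] sym pos by blast
  have nn: "mvn_density \<mu> (matrix_inv V) x \<ge> 0" for x
    using dV by (simp add: eq)
  let ?B = "sqrt ((2 * pi) ^ CARD('n) / det V)"
  have B: "?B > 0" using dV by simp
  have "(\<integral>\<^sup>+ x. ennreal (exp (- ((x - \<mu>) \<bullet> (V *v (x - \<mu>))) / 2)) \<partial>lborel)
      = (\<integral>\<^sup>+ x. ennreal (exp (- (x \<bullet> (V *v x)) / 2)) \<partial>distr lborel borel ((+) (- \<mu>)))"
    by (subst nn_integral_distr) auto
  also have "\<dots> = ennreal ?B"
    using nn_integral_exp_neg_quadratic(2)[of V] sym pos by (simp add: lborel_distr_plus)
  finally have "(\<integral>\<^sup>+ x. ennreal (mvn_density \<mu> (matrix_inv V) x) \<partial>lborel) = ennreal ?B / ennreal ?B"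
    unfolding eq using B
    by (simp add: divide_ennreal[symmetric] nn_integral_divide)
  then have nni: "(\<integral>\<^sup>+ x. ennreal (mvn_density \<mu> (matrix_inv V) x) \<partial>lborel) = 1"
    by (subst (asm) ennreal_divide_self) (use B in \<open>auto simp only: ennreal_eq_0_iff ennreal_less_top not_le\<close>)
  then show int: "integrable lborel (mvn_density \<mu> (matrix_inv V))"
    by (intro integrableI_nonneg) (auto simp: nn)
  show "(\<integral>x. mvn_density \<mu> (matrix_inv V) x \<partial>lborel) = 1"
    by (subst integral_eq_nn_integral) (auto simp: nn nni)
  show "mvn_prob B \<mu> (matrix_inv V) = (LINT x:B|lborel. mvn_density \<mu> (matrix_inv V) x)" if [measurable]: "B \<in> sets borel"
  proof -
    have "(LINT x:B|lborel. mvn_density \<mu> (matrix_inv V) x)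
        = enn2real (\<integral>\<^sup>+ x. ennreal (mvn_density \<mu> (matrix_inv V) x) * indicator B x \<partial>lborel)"
      unfolding set_lebesgue_integral_def
      by (subst integral_eq_nn_integral)
        (auto simp: nn intro!: arg_cong[where f=enn2real] nn_integral_cong split: split_indicator)
    then show ?thesis
      by (simp add: mvn_prob_def measure_def emeasure_density)
  qed
qed

section \<open>Total variation distance\<close>

text \<open>The difference \<open>d\<close> has total integral 0, so its integrals over
  \<open>B\<close> and over the complement are opposite. Their difference is at most the integral of
  \<open>\<bar>d\<bar>\<close>, which gives the factor 1/2.\<close>

lemma SUP_set_integral_diff:
  fixes f g :: "'a::euclidean_space \<Rightarrow> real"
  assumes f: "integrable lborel f" and g: "integrable lborel g"
    and eq: "(\<integral>x. f x \<partial>lborel) = (\<integral>x. g x \<partial>lborel)"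
  shows "(SUP B\<in>sets borel. \<bar>(LINT x:B|lborel. f x) - (LINT x:B|lborel. g x)\<bar>)
    = (\<integral>x. \<bar>f x - g x\<bar> \<partial>lborel) / 2"
proof -
  define d where "d x = f x - g x" for x
  have d: "integrable lborel d" unfolding d_def using f g by simp
  have [measurable]: "f \<in> borel_measurable borel" "g \<in> borel_measurable borel"
    using f g by (auto dest: borel_measurable_integrable)
  have dm[measurable]: "d \<in> borel_measurable borel" using d by (auto dest: borel_measurable_integrable)
  have si: "set_integrable lborel B h" if "B \<in> sets borel" "integrable lborel h" for B and h :: "'a \<Rightarrow> real"
    unfolding set_integrable_def using that by (intro integrable_mult_indicator) auto
  have ind: "integrable lborel (\<lambda>x. indicator B x *\<^sub>R d x)" if "B \<in> sets borel" for B
    using si[OF that d] by (simp add: set_integrable_def)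
  have diff: "(LINT x:B|lborel. f x) - (LINT x:B|lborel. g x) = (LINT x:B|lborel. d x)" if "B \<in> sets borel" for B
    unfolding d_def by (rule set_integral_diff(2)[symmetric]) (use si that f g in auto)
  have tot: "(\<integral>x. d x \<partial>lborel) = 0" using f g eq by (simp add: d_def)
  have compl: "(LINT x:- B|lborel. d x) = - (LINT x:B|lborel. d x)" if [measurable]: "B \<in> sets borel" for B
  proof -
    have "(LINT x:- B|lborel. d x) + (LINT x:B|lborel. d x) = (\<integral>x. indicator (- B) x *\<^sub>R d x + indicator B x *\<^sub>R d x \<partial>lborel)"
      unfolding set_lebesgue_integral_def
      by (rule Bochner_Integration.integral_add[symmetric]) (use ind that in auto)
    also have "\<dots> = (\<integral>x. d x \<partial>lborel)"
      by (rule Bochner_Integration.integral_cong) (auto split: split_indicator)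
    finally show ?thesis using tot by simp
  qed
  have upper: "(LINT x:B|lborel. d x) \<le> (\<integral>x. \<bar>d x\<bar> \<partial>lborel) / 2" if [measurable]: "B \<in> sets borel" for B
  proof -
    have "(LINT x:B|lborel. d x) - (LINT x:- B|lborel. d x) = (\<integral>x. indicator B x *\<^sub>R d x - indicator (- B) x *\<^sub>R d x \<partial>lborel)"
      unfolding set_lebesgue_integral_def
      by (rule Bochner_Integration.integral_diff[symmetric]) (use ind that in auto)
    also have "\<dots> \<le> (\<integral>x. \<bar>d x\<bar> \<partial>lborel)"
      by (rule integral_mono) (use d ind that in \<open>auto intro!: Bochner_Integration.integrable_diff split: split_indicator\<close>)
    finally show ?thesis using compl[OF that] by simp
  qed
  have le: "\<bar>(LINT x:B|lborel. f x) - (LINT x:B|lborel. g x)\<bar> \<le> (\<integral>x. \<bar>d x\<bar> \<partial>lborel) / 2" if "B \<in> sets borel" for B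
    using upper[OF that] upper[of "- B"] compl[OF that] that diff[OF that] by (auto simp: abs_le_iff)
  \<comment> \<open>The supremum is attained where \<open>d\<close> is positive.\<close>
  let ?P = "{x. d x > 0}"
  have P[measurable]: "?P \<in> sets borel" by measurable
  have "(LINT x:?P|lborel. d x) - (LINT x:- ?P|lborel. d x) = (\<integral>x. indicator ?P x *\<^sub>R d x - indicator (- ?P) x *\<^sub>R d x \<partial>lborel)"
    unfolding set_lebesgue_integral_def
    by (rule Bochner_Integration.integral_diff[symmetric]) (use ind P in auto)
  also have "\<dots> = (\<integral>x. \<bar>d x\<bar> \<partial>lborel)"
    by (rule Bochner_Integration.integral_cong) (auto split: split_indicator)
  finally have "(LINT x:?P|lborel. d x) = (\<integral>x. \<bar>d x\<bar> \<partial>lborel) / 2" using compl[OF P] by simp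
  moreover have abs_nn: "0 \<le> (\<integral>x. \<bar>d x\<bar> \<partial>lborel)" by (rule Bochner_Integration.integral_nonneg) simp
  ultimately have att: "\<bar>(LINT x:?P|lborel. f x) - (LINT x:?P|lborel. g x)\<bar> = (\<integral>x. \<bar>d x\<bar> \<partial>lborel) / 2"
    using diff[OF P] by linarith
  show ?thesis unfolding d_def[symmetric]
  proof (rule antisym)
    show "(SUP B\<in>sets borel. \<bar>(LINT x:B|lborel. f x) - (LINT x:B|lborel. g x)\<bar>) \<le> (\<integral>x. \<bar>d x\<bar> \<partial>lborel) / 2"
      by (rule cSUP_least) (use le P in auto)
    show "(\<integral>x. \<bar>d x\<bar> \<partial>lborel) / 2 \<le> (SUP B\<in>sets borel. \<bar>(LINT x:B|lborel. f x) - (LINT x:B|lborel. g x)\<bar>)"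
      by (subst att[symmetric], rule cSUP_upper[OF P]) (rule bdd_aboveI2, rule le)
  qed
qed

section \<open>Posterior approximation for nearly quadratic convex losses\<close>

text \<open>Write \<open>a / A - b / B = (a - b) / B + a * (1 / A - 1 / B)\<close>. The second part
  integrates to \<open>\<bar>A - B\<bar> / B\<close>, again at most the L1 distance over
  \<open>B\<close>; hence the factor 2. Only the normaliser of \<open>b\<close> occurs in the bound,
  and for the normal kernel it is a fixed constant.\<close>

lemma integral_normalised_diff_le:
  fixes a b :: "'a \<Rightarrow> real"
  assumes a: "integrable M a" "\<And>x. a x \<ge> 0" "(\<integral>x. a x \<partial>M) > 0"
    and b: "integrable M b" "(\<integral>x. b x \<partial>M) > 0"
  shows "(\<integral>x. \<bar>a x / (\<integral>x. a x \<partial>M) - b x / (\<integral>x. b x \<partial>M)\<bar> \<partial>M) \<le> 2 * (\<integral>x. \<bar>a x - b x\<bar> \<partial>M) / (\<integral>x. b x \<partial>M)"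
proof -
  let ?A = "\<integral>x. a x \<partial>M" and ?B = "\<integral>x. b x \<partial>M"
  have ab: "integrable M (\<lambda>x. \<bar>a x - b x\<bar>)" using a b by simp
  have "(\<integral>x. \<bar>a x / ?A - b x / ?B\<bar> \<partial>M) \<le> (\<integral>x. \<bar>a x - b x\<bar> / ?B + a x * \<bar>1 / ?A - 1 / ?B\<bar> \<partial>M)"
  proof (rule integral_mono)
    fix x
    have "a x / ?A - b x / ?B = (a x - b x) / ?B + a x * (1 / ?A - 1 / ?B)"
      by (simp add: field_simps diff_divide_distrib)
    also have "\<bar>\<dots>\<bar> \<le> \<bar>(a x - b x) / ?B\<bar> + \<bar>a x * (1 / ?A - 1 / ?B)\<bar>" by (rule abs_triangle_ineq)
    finally show "\<bar>a x / ?A - b x / ?B\<bar> \<le> \<bar>a x - b x\<bar> / ?B + a x * \<bar>1 / ?A - 1 / ?B\<bar>"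
      using a(2)[of x] b(2) by (simp add: abs_mult)
  qed (use a b ab in auto)
  also have "\<dots> = (\<integral>x. \<bar>a x - b x\<bar> \<partial>M) / ?B + ?A * \<bar>1 / ?A - 1 / ?B\<bar>"
    using a b ab by simp
  also have "?A * \<bar>1 / ?A - 1 / ?B\<bar> = \<bar>?A - ?B\<bar> / ?B"
  proof -
    have "?A * \<bar>1 / ?A - 1 / ?B\<bar> = \<bar>?A * (1 / ?A - 1 / ?B)\<bar>" using a(3) by (simp add: abs_mult)
    also have "?A * (1 / ?A - 1 / ?B) = (?B - ?A) / ?B" using a(3) b(2) by (simp add: field_simps)
    finally show ?thesis using b(2) by (simp add: abs_minus_commute)
  qed
  also have "\<bar>?A - ?B\<bar> \<le> (\<integral>x. \<bar>a x - b x\<bar> \<partial>M)"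
    using integral_abs_bound[of M "\<lambda>x. a x - b x"] a b by simp
  finally show ?thesis using b(2) by (simp add: divide_right_mono field_simps)
qed

text \<open>The constant \<open>\<kappa>\<close> is a lower bound for the spectrum of
  \<open>V\<close>; as a parameter it makes the tail rates and closeness thresholds below
  explicit.\<close>

locale pos_def =
  fixes V :: "real^'n^'n" and \<kappa> :: real
  assumes inv: "invertible V" and sym: "\<And>x y. x \<bullet> (V *v y) = y \<bullet> (V *v x)"
    and kappa_pos: "\<kappa> > 0" and coercive: "\<And>x. \<kappa> * (norm x)\<^sup>2 \<le> x \<bullet> (V *v x)"
begin

definition q where "q x = x \<bullet> (V *v x) / 2"

lemma q_ge: "\<kappa> / 2 * (norm x)\<^sup>2 \<le> q x" using coercive[of x] by (simp add: q_def)

lemma q_nonneg: "0 \<le> q x" using q_ge[of x] kappa_pos by (smt (verit) mult_nonneg_nonneg zero_le_power2 half_gt_zero)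

lemma pos: "x \<noteq> 0 \<Longrightarrow> x \<bullet> (V *v x) > 0"
  using coercive[of x] kappa_pos by (smt (verit) mult_pos_pos zero_less_norm_iff zero_less_power)

lemma continuous_q: "continuous_on A q"
  unfolding q_def by (intro continuous_intros linear_continuous_on_compose matrix_vector_mul_linear) auto

lemma q_diff: "q x - q y = (x - y) \<bullet> (V *v (x + y)) / 2"
  using sym[of x y] by (simp add: q_def matrix_vector_right_distrib inner_add_right inner_diff_left diff_divide_distrib add_divide_distrib)

text \<open>With score \<open>W = V *v m\<close>, the quadratic approximation of the loss is centred
  at \<open>m\<close>, up to the constant \<open>q m\<close>.\<close>

lemma q_complete_square: "q h - (V *v m) \<bullet> h + q m = q (h - m)"
  using sym[of h m] by (simp add: q_def matrix_vector_mult_diff_distrib inner_diff_right inner_diff_left inner_commute field_simps)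

abbreviation post_density where
  "post_density D prior h \<equiv> exp (- D h) * prior h / (\<integral>h. exp (- D h) * prior h \<partial>lborel)"

abbreviation "normal_dens \<mu> \<equiv> mvn_density \<mu> (matrix_inv V)"

lemma normal_dens_eq: "normal_dens \<mu> x = exp (- q (x - \<mu>)) / (\<integral>x. exp (- q (x - \<mu>)) \<partial>lborel)"
  and integrable_exp_q: "integrable lborel (\<lambda>x. exp (- q (x - \<mu>)))"
  and integral_exp_q: "(\<integral>x. exp (- q (x - \<mu>)) \<partial>lborel) = sqrt ((2 * pi) ^ CARD('n) / det V)" "det V > 0"
proof -
  let ?B = "sqrt ((2 * pi) ^ CARD('n) / det V)"
  show dV: "det V > 0" using nn_integral_exp_neg_quadratic(1)[of V] sym pos by blast
  then have B: "?B > 0" by simp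
  have n: "normal_dens \<mu> x = exp (- q (x - \<mu>)) / ?B" for x
    by (simp add: mvn_density_inv_eq[OF inv] q_def)
  have e: "exp (- q (x - \<mu>)) = ?B * normal_dens \<mu> x" for x using B n dV by simp
  show "integrable lborel (\<lambda>x. exp (- q (x - \<mu>)))"
    unfolding e using mvn_density_integrable[OF inv] sym pos by (intro integrable_mult_right) blast
  show i: "(\<integral>x. exp (- q (x - \<mu>)) \<partial>lborel) = ?B"
    unfolding e using mvn_density_integral[OF inv, of \<mu>] sym pos by simp
  show "normal_dens \<mu> x = exp (- q (x - \<mu>)) / (\<integral>x. exp (- q (x - \<mu>)) \<partial>lborel)"
    by (simp only: n i)
qed

text \<open>\<open>D h + q m\<close> is close to \<open>q (h - m)\<close> on a ball; convexity along rays from \<open>m\<close> turns this into a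
  linear lower bound outside.\<close>

lemma convex_growth:
  assumes D: "convex_on UNIV D" and W: "W = V *v m"
    and close: "\<And>h. norm h \<le> norm m + 1 \<Longrightarrow> \<bar>D h + W \<bullet> h - q h\<bar> \<le> \<delta>"
    and r: "0 < r" "r \<le> 1" "norm (h - m) \<ge> r"
  shows "D h + q m \<ge> norm (h - m) / r * (\<kappa> / 2 * r\<^sup>2 - 2 * \<delta>) + \<delta>"
    and "\<bar>D m + q m\<bar> \<le> \<delta>"
proof -
  have E: "\<bar>D h + q m - q (h - m)\<bar> \<le> \<delta>" if "norm h \<le> norm m + 1" for h
    using close[OF that] q_complete_square[of h m] W by (simp add: algebra_simps)
  have q0: "q 0 = 0" by (simp add: q_def)
  show Em: "\<bar>D m + q m\<bar> \<le> \<delta>" using E[of m] by (simp add: q0)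
  define \<rho> where "\<rho> = norm (h - m)"
  have \<rho>: "\<rho> \<ge> r" "\<rho> > 0" using r by (auto simp: \<rho>_def)
  define t where "t = r / \<rho>"
  have t: "0 < t" "t \<le> 1" using \<rho> r by (auto simp: t_def)
  \<comment> \<open>\<open>u\<close> is the point of the segment from \<open>m\<close> to
    \<open>h\<close> at distance \<open>r\<close> from \<open>m\<close>; since
    \<open>r \<le> 1\<close>, it lies in the ball where \<open>D\<close> is controlled.\<close>
  define u where "u = m + t *\<^sub>R (h - m)"
  have um: "norm (u - m) = r" using \<rho> r by (simp add: u_def t_def \<rho>_def[symmetric])
  have "norm u \<le> norm m + 1" using norm_triangle_ineq[of m "u - m"] um r by simp
  then have "D u + q m \<ge> q (u - m) - \<delta>" using E[of u] by linarith
  moreover have "q (u - m) \<ge> \<kappa> / 2 * r\<^sup>2" using q_ge[of "u - m"] um by simp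
  moreover have "D u \<le> (1 - t) * D m + t * D h"
    using convex_onD[OF D, of t m h] t by (simp add: u_def algebra_simps)
  ultimately have 1: "\<kappa> / 2 * r\<^sup>2 - \<delta> \<le> (1 - t) * (D m + q m) + t * (D h + q m)"
    by (simp add: algebra_simps)
  have "(1 - t) * (D m + q m) \<le> (1 - t) * \<delta>" using Em t by (intro mult_left_mono) auto
  with 1 have "\<kappa> / 2 * r\<^sup>2 - 2 * \<delta> \<le> t * (D h + q m - \<delta>)" by (simp add: algebra_simps)
  then have "(\<kappa> / 2 * r\<^sup>2 - 2 * \<delta>) / t \<le> D h + q m - \<delta>" using t by (simp add: field_simps)
  then show "D h + q m \<ge> norm (h - m) / r * (\<kappa> / 2 * r\<^sup>2 - 2 * \<delta>) + \<delta>"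
    using r by (simp add: t_def \<rho>_def field_simps)
qed

text \<open>Since \<open>D m + q m\<close> is at most \<open>\<delta>\<close>, while at distance
  \<open>r\<close> or more \<open>D + q m\<close> strictly exceeds \<open>\<delta>\<close>, no point
  that far out can do as well as \<open>m\<close>.\<close>

lemma argmin_near:
  assumes D: "convex_on UNIV D" and W: "W = V *v m"
    and close: "\<And>h. norm h \<le> norm m + 1 \<Longrightarrow> \<bar>D h + W \<bullet> h - q h\<bar> \<le> \<delta>"
    and r: "0 < r" "r \<le> 1" and \<delta>: "4 * \<delta> < \<kappa> * r\<^sup>2" and min: "D x \<le> D m"
  shows "norm (x - m) < r"
proof (rule ccontr)
  assume "\<not> norm (x - m) < r"
  then have xr: "norm (x - m) \<ge> r" by simp
  have "D x + q m \<ge> norm (x - m) / r * (\<kappa> / 2 * r\<^sup>2 - 2 * \<delta>) + \<delta>" and m: "\<bar>D m + q m\<bar> \<le> \<delta>"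
    using convex_growth[OF D W close r xr] by auto
  moreover have "norm (x - m) / r * (\<kappa> / 2 * r\<^sup>2 - 2 * \<delta>) > 0"
    using xr r \<delta> by (intro mult_pos_pos divide_pos_pos) auto
  ultimately show False using min by linarith
qed

text \<open>Radius \<open>k\<close> and tolerance \<open>1 / Suc k\<close> give convergence on every
  fixed ball, while the bound on \<open>W\<close> keeps the centres \<open>m k\<close> in a bounded
  set, so one majorant can serve all large \<open>k\<close>.\<close>

lemma posterior_L1_tendsto:
  fixes D :: "nat \<Rightarrow> real^'n \<Rightarrow> real" and W x :: "nat \<Rightarrow> real^'n" and prior :: "real^'n \<Rightarrow> real"
  assumes D: "\<And>k. convex_on UNIV (D k)" and WK: "\<And>k. norm (W k) \<le> K"
    and close: "\<And>k h. norm h \<le> real k \<Longrightarrow> \<bar>D k h + W k \<bullet> h - q h\<bar> \<le> 1 / Suc k"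
    and min: "\<And>k h. D k (x k) \<le> D k h"
    and prior: "\<And>b. 0 \<le> prior b" "bounded (range prior)" "continuous_on UNIV prior" "prior \<beta>0 > 0"
    and s: "s \<longlonglongrightarrow> (0::real)"
  shows "(\<lambda>k. \<integral>h. \<bar>post_density (D k) (\<lambda>h. prior (\<beta>0 + s k *\<^sub>R h)) h - normal_dens (x k) h\<bar> \<partial>lborel) \<longlonglongrightarrow> 0"
proof -
  define m where "m k = matrix_inv V *v W k" for k
  have W: "W k = V *v m k" for k by (simp add: m_def matrix_inv_cancel[OF inv])
  obtain C where C: "\<And>y. norm (matrix_inv V *v y) \<le> C * norm y" "C > 0"
    using linear_bounded_pos[OF matrix_vector_mul_linear] by blast
  define K' where "K' = C * K"
  have mK: "norm (m k) \<le> K'" for k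
    unfolding m_def K'_def using C WK by (meson mult_left_mono less_imp_le order_trans)
  then have K': "K' \<ge> 0" using norm_ge_zero order_trans by blast
  obtain PB where PB: "\<And>b. prior b \<le> PB" using prior(2) by (auto simp: bounded_iff abs_le_iff)
  define P where "P = PB / prior \<beta>0"
  have PBpos: "PB > 0" using PB[of \<beta>0] prior(4) by linarith
  have P: "P > 0" "\<And>b. prior b / prior \<beta>0 \<le> P"
    using PB prior(4) PBpos by (auto simp: P_def divide_right_mono)
  have ev_close: "\<forall>\<^sub>F k in sequentially. \<forall>h. norm h \<le> norm (m k) + 1 \<longrightarrow> \<bar>D k h + W k \<bullet> h - q h\<bar> \<le> 1 / Suc k"
    using eventually_ge_at_top[of "nat \<lceil>K' + 1\<rceil>"]
  proof eventually_elim
    case (elim k)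
    have "norm (m k) + 1 \<le> real k" using mK[of k] elim by linarith
    then show ?case using close by (meson order_trans)
  qed
  have del0: "(\<lambda>k. 1 / real (Suc k)) \<longlonglongrightarrow> 0" by (rule LIMSEQ_Suc[OF lim_1_over_n])
  \<comment> \<open>For each fixed \<open>r\<close> the tolerance \<open>1 / Suc k\<close>
    eventually drops below \<open>\<kappa> * r\<^sup>2 / 4\<close>, the threshold of
    \<open>argmin_near\<close>.\<close>
  have xm: "(\<lambda>k. x k - m k) \<longlonglongrightarrow> 0"
  proof (rule LIMSEQ_I)
    fix e :: real assume e: "e > 0"
    define r where "r = min e 1"
    have r: "0 < r" "r \<le> 1" "r \<le> e" using e by (auto simp: r_def)
    have "\<kappa> * r\<^sup>2 / 4 > 0" using kappa_pos r by simp
    with del0 have "\<forall>\<^sub>F k in sequentially. 1 / Suc k < \<kappa> * r\<^sup>2 / 4" by (rule order_tendstoD(2))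
    with ev_close have "\<forall>\<^sub>F k in sequentially. norm (x k - m k - 0) < e"
    proof eventually_elim
      case (elim k)
      have "norm (x k - m k) < r"
        using argmin_near[OF D[of k] W[of k], of "1 / Suc k" r "x k"] elim r min by (simp add: field_simps)
      then show ?case using r by simp
    qed
    then show "\<exists>no. \<forall>n\<ge>no. norm (x n - m n - 0) < e" by (simp add: eventually_sequentially)
  qed
  \<comment> \<open>Multiplying the posterior kernel by
    \<open>exp (- q (m k)) / prior \<beta>0\<close> makes it comparable with the normal kernel; this
    factor is free of \<open>h\<close> and cancels on normalisation.\<close>
  define pr where "pr k h = prior (\<beta>0 + s k *\<^sub>R h) / prior \<beta>0" for k h
  define a where "a k h = exp (- (D k h + q (m k))) * pr k h" for k h
  define b where "b k h = exp (- q (h - x k))" for k h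
  define B where "B = sqrt ((2 * pi) ^ CARD('n) / det V)"
  have B: "B > 0" using integral_exp_q(2) by (simp add: B_def)
  have bint: "integrable lborel (b k)" "(\<integral>h. b k h \<partial>lborel) = B" for k
    unfolding b_def B_def using integrable_exp_q integral_exp_q by auto
  have D_meas[measurable]: "D k \<in> borel_measurable borel" for k
    by (rule borel_measurable_continuous_onI, rule convex_on_continuous[OF open_UNIV D])
  have prior_meas[measurable]: "prior \<in> borel_measurable borel"
    using prior(3) by (rule borel_measurable_continuous_onI)
  have a_meas[measurable]: "a k \<in> borel_measurable borel" for k
    unfolding a_def pr_def by measurable
  have b_meas[measurable]: "b k \<in> borel_measurable borel" for k
    using bint(1) by (auto dest: borel_measurable_integrable)
  have pr0: "0 \<le> pr k h" and prP: "pr k h \<le> P" for k h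
    using prior(1,4) P(2) by (auto simp: pr_def)
  have a0: "0 \<le> a k h" for k h using pr0 by (simp add: a_def)
  \<comment> \<open>The two constants bound \<open>a\<close> and \<open>b\<close> once
    \<open>norm (h - m k)\<close> and \<open>norm (h - x k)\<close> are replaced by
    \<open>norm h\<close>, at the cost of \<open>K'\<close> and \<open>K' + 1\<close>.\<close>
  define G where "G h = (P * exp (1 + \<kappa> / 4 + \<kappa> / 4 * K') + exp (\<kappa> / 4 + \<kappa> / 4 * (K' + 1))) * exp (- (\<kappa> / 4) * norm h)" for h :: "real^'n"
  have G: "integrable lborel G"
    unfolding G_def using integrable_exp_neg_norm[of "\<kappa> / 4"] kappa_pos by (intro integrable_mult_right) auto
  have bnd: "\<forall>\<^sub>F k in sequentially. \<forall>h. a k h + b k h \<le> G h"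
  proof -
    have "\<forall>\<^sub>F k in sequentially. 1 / Suc k < \<kappa> / 8"
      using del0 by (rule order_tendstoD(2)) (use kappa_pos in simp)
    moreover have "\<forall>\<^sub>F k in sequentially. norm (x k - m k) < 1"
      using tendsto_norm[OF xm] by (rule order_tendstoD(2)) simp
    ultimately show ?thesis using ev_close
    proof eventually_elim
      case (elim k)
      have mh: "norm h \<le> norm (h - m k) + K'" for h
        using norm_triangle_ineq[of "h - m k" "m k"] mK[of k] by simp
      have xK: "norm (x k) \<le> K' + 1"
        using norm_triangle_ineq[of "x k - m k" "m k"] mK[of k] elim(2) by simp
      \<comment> \<open>Outside the unit ball about \<open>m k\<close>, \<open>convex_growth\<close>
        with \<open>r = 1\<close> has slope \<open>\<kappa> / 2 - 2 / Suc k\<close>, which is at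
        least \<open>\<kappa> / 4\<close> because \<open>1 / Suc k < \<kappa> / 8\<close>. Inside,
        nonnegativity of \<open>q\<close> suffices and the additive constants absorb the
        slope.\<close>
      have E: "D k h + q (m k) \<ge> \<kappa> / 4 * norm (h - m k) - 1 - \<kappa> / 4" for h
      proof (cases "norm (h - m k) \<ge> 1")
        case True
        have "norm (h - m k) * (\<kappa> / 2 - 2 * (1 / Suc k)) + 1 / Suc k \<le> D k h + q (m k)"
          using convex_growth(1)[OF D[of k] W[of k], of "1 / Suc k" 1 h] elim(3) True by simp
        moreover have "\<kappa> / 4 * norm (h - m k) \<le> norm (h - m k) * (\<kappa> / 2 - 2 * (1 / Suc k))"
          using elim(1) by (subst mult.commute, intro mult_left_mono) auto
        moreover have "0 \<le> 1 / real (Suc k)" by simp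
        ultimately show ?thesis using kappa_pos by linarith
      next
        case False
        then have "norm h \<le> norm (m k) + 1" using norm_triangle_ineq[of "h - m k" "m k"] by simp
        then have "\<bar>D k h + W k \<bullet> h - q h\<bar> \<le> 1 / Suc k" using elim(3) by blast
        then have "D k h + q (m k) \<ge> q (h - m k) - 1 / Suc k"
          using q_complete_square[of h "m k"] W[of k] by (simp add: algebra_simps)
        moreover have "1 / real (Suc k) \<le> 1" by simp
        moreover have "\<kappa> / 4 * norm (h - m k) \<le> \<kappa> / 4" using False kappa_pos by (simp add: mult_left_le)
        ultimately show ?thesis using q_nonneg[of "h - m k"] by linarith
      qed
      show ?case
      proof
        fix h
        have ab: "a k h \<le> exp (1 + \<kappa> / 4 + \<kappa> / 4 * K' - \<kappa> / 4 * norm h) * P"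
          unfolding a_def
        proof (rule mult_mono)
          have "\<kappa> / 4 * norm h \<le> \<kappa> / 4 * (norm (h - m k) + K')" using mh[of h] kappa_pos by (intro mult_left_mono) auto
          then show "exp (- (D k h + q (m k))) \<le> exp (1 + \<kappa> / 4 + \<kappa> / 4 * K' - \<kappa> / 4 * norm h)"
            using E[of h] by (simp add: distrib_left)
        qed (use pr0 prP in auto)
        have bb: "b k h \<le> exp (\<kappa> / 4 + \<kappa> / 4 * (K' + 1) - \<kappa> / 4 * norm h)"
        proof -
          have "norm h \<le> norm (h - x k) + (K' + 1)"
            using norm_triangle_ineq[of "h - x k" "x k"] xK by simp
          then have "\<kappa> / 4 * norm h \<le> \<kappa> / 4 * (norm (h - x k) + (K' + 1))" using kappa_pos by (intro mult_left_mono) auto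
          moreover have "\<kappa> / 4 * (norm (h - x k) - 1) \<le> \<kappa> / 4 * (2 * (norm (h - x k))\<^sup>2)"
          proof (intro mult_left_mono)
            have "0 \<le> 2 * (norm (h - x k) - 1/4)\<^sup>2 + 7/8" by simp
            then show "norm (h - x k) - 1 \<le> 2 * (norm (h - x k))\<^sup>2" by (simp add: power2_eq_square algebra_simps)
          qed (use kappa_pos in simp)
          ultimately show ?thesis using q_ge[of "h - x k"]
            unfolding b_def exp_le_cancel_iff distrib_left right_diff_distrib by linarith
        qed
        have e: "exp (c - \<kappa> / 4 * norm h) = exp c * exp (- (\<kappa> / 4) * norm h)" for c
          by (subst mult_exp_exp) simp
        have "a k h + b k h \<le> exp (1 + \<kappa> / 4 + \<kappa> / 4 * K') * exp (- (\<kappa> / 4) * norm h) * P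
            + exp (\<kappa> / 4 + \<kappa> / 4 * (K' + 1)) * exp (- (\<kappa> / 4) * norm h)"
          using add_mono[OF ab bb] unfolding e .
        also have "\<dots> = G h" unfolding G_def distrib_right by (simp only: mult_ac)
        finally show "a k h + b k h \<le> G h" .
      qed
    qed
  qed
  have lim: "(\<lambda>k. a k h - b k h) \<longlonglongrightarrow> 0" for h
  proof -
    define e where "e k = D k h + q (m k) - q (h - m k)" for k
    have "e \<longlonglongrightarrow> 0"
    proof (rule Lim_null_comparison[OF _ del0])
      show "\<forall>\<^sub>F k in sequentially. norm (e k) \<le> 1 / Suc k"
        using eventually_ge_at_top[of "nat \<lceil>norm h\<rceil>"]
      proof eventually_elim
        case (elim k)
        then have "norm h \<le> real k" by linarith
        then show ?case using close[of h k] q_complete_square[of h "m k"] W[of k] by (simp add: e_def algebra_simps)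
      qed
    qed
    moreover have "(\<lambda>k. pr k h) \<longlonglongrightarrow> prior (\<beta>0 + 0 *\<^sub>R h) / prior \<beta>0"
      unfolding pr_def
      by (intro tendsto_divide continuous_on_tendsto_compose[OF prior(3)] tendsto_intros s) (use prior(4) in auto)
    ultimately have "(\<lambda>k. exp (- e k) * pr k h - 1) \<longlonglongrightarrow> exp (- 0) * (prior (\<beta>0 + 0 *\<^sub>R h) / prior \<beta>0) - 1"
      by (intro tendsto_intros)
    then have l1: "(\<lambda>k. exp (- e k) * pr k h - 1) \<longlonglongrightarrow> 0" using prior(4) by simp
    have c1: "(\<lambda>k. exp (- q (h - m k)) * (exp (- e k) * pr k h - 1)) \<longlonglongrightarrow> 0"
    proof (rule Lim_null_comparison[OF _ tendsto_norm_zero[OF l1]])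
      show "\<forall>\<^sub>F k in sequentially. norm (exp (- q (h - m k)) * (exp (- e k) * pr k h - 1)) \<le> norm (exp (- e k) * pr k h - 1)"
        using q_nonneg by (intro always_eventually allI) (simp add: abs_mult mult_left_le_one_le)
    qed
    obtain CV where CV: "\<And>y. norm (V *v y) \<le> CV * norm y" "CV > 0"
      using linear_bounded_pos[OF matrix_vector_mul_linear] by blast
    have c2: "(\<lambda>k. exp (- q (h - m k)) - exp (- q (h - x k))) \<longlonglongrightarrow> 0"
    proof (rule Lim_null_comparison)
      have lip: "\<bar>exp (- u) - exp (- v)\<bar> \<le> \<bar>u - v\<bar>" if "0 \<le> u" "0 \<le> v" for u v :: real
      proof -
        have 1: "exp (- u) - exp (- v) \<le> v - u" if "0 \<le> u" "u \<le> v" for u v :: real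
        proof -
          have "1 - exp (u - v) \<le> v - u" using exp_ge_add_one_self[of "u - v"] by linarith
          then have "exp (- u) * (1 - exp (u - v)) \<le> 1 * (v - u)"
            by (intro mult_mono) (use that in simp_all)
          then show ?thesis by (simp add: algebra_simps exp_add[symmetric])
        qed
        show ?thesis using 1[of u v] 1[of v u] that by (cases "u \<le> v") auto
      qed
      show "\<forall>\<^sub>F k in sequentially. norm (exp (- q (h - m k)) - exp (- q (h - x k)))
          \<le> norm (x k - m k) * (CV * (2 * norm h + 2 * K' + 1))"
        using order_tendstoD(2)[OF tendsto_norm[OF xm], of 1, simplified]
      proof eventually_elim
        case (elim k)
        have xK: "norm (x k) \<le> K' + 1"
          using norm_triangle_ineq[of "x k - m k" "m k"] mK[of k] elim by simp
        have "\<bar>exp (- q (h - m k)) - exp (- q (h - x k))\<bar> \<le> \<bar>q (h - m k) - q (h - x k)\<bar>"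
          using lip q_nonneg by blast
        also have "\<dots> = \<bar>(x k - m k) \<bullet> (V *v ((h - m k) + (h - x k)))\<bar> / 2" by (simp add: q_diff)
        also have "\<dots> \<le> \<bar>(x k - m k) \<bullet> (V *v ((h - m k) + (h - x k)))\<bar>" by simp
        also have "\<dots> \<le> norm (x k - m k) * norm (V *v ((h - m k) + (h - x k)))" by (rule Cauchy_Schwarz_ineq2)
        also have "\<dots> \<le> norm (x k - m k) * (CV * (2 * norm h + 2 * K' + 1))"
        proof (intro mult_left_mono order_trans[OF CV(1)])
          have "norm ((h - m k) + (h - x k)) \<le> (norm h + norm (m k)) + (norm h + norm (x k))"
            by (meson add_mono norm_triangle_ineq norm_triangle_ineq4 order_trans)
          then show "norm ((h - m k) + (h - x k)) \<le> 2 * norm h + 2 * K' + 1" using xK mK[of k] by simp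
        qed (use CV in auto)
        finally show ?case by simp
      qed
      show "(\<lambda>k. norm (x k - m k) * (CV * (2 * norm h + 2 * K' + 1))) \<longlonglongrightarrow> 0"
        by (rule tendsto_mult_left_zero[OF tendsto_norm_zero[OF xm]])
    qed
    \<comment> \<open>The comparison passes through the normal kernel centred at \<open>m k\<close>:
      first the loss is replaced by its quadratic approximation, then the centre moves from
      \<open>m k\<close> to \<open>x k\<close>.\<close>
    have "a k h - b k h = exp (- q (h - m k)) * (exp (- e k) * pr k h - 1) + (exp (- q (h - m k)) - exp (- q (h - x k)))" for k
    proof -
      have "exp (- (D k h + q (m k))) = exp (- q (h - m k)) * exp (- e k)"
        by (simp add: e_def exp_add[symmetric])
      then show ?thesis by (simp add: a_def b_def algebra_simps)
    qed
    then show ?thesis using tendsto_add[OF c1 c2] by simp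
  qed
  have main: "(\<lambda>k. \<integral>h. \<bar>a k h - b k h\<bar> \<partial>lborel) \<longlonglongrightarrow> 0"
  proof -
    obtain k0 where k0: "\<And>k h. k \<ge> k0 \<Longrightarrow> a k h + b k h \<le> G h"
      using bnd by (auto simp: eventually_sequentially)
    have "(\<lambda>k. \<integral>h. \<bar>a (k + k0) h - b (k + k0) h\<bar> \<partial>lborel) \<longlonglongrightarrow> (\<integral>h. 0 \<partial>(lborel :: (real^'n) measure))"
    proof (rule integral_dominated_convergence[where w=G])
      show "AE h in lborel. (\<lambda>k. \<bar>a (k + k0) h - b (k + k0) h\<bar>) \<longlonglongrightarrow> 0"
        using LIMSEQ_ignore_initial_segment[OF tendsto_rabs_zero[OF lim]] by simp
      show "AE h in lborel. norm \<bar>a (k + k0) h - b (k + k0) h\<bar> \<le> G h" for k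
      proof (rule AE_I2)
        fix h
        have "0 \<le> b (k + k0) h" by (simp add: b_def)
        then show "norm \<bar>a (k + k0) h - b (k + k0) h\<bar> \<le> G h"
          using k0[of "k + k0" h] a0[of "k + k0" h] by simp
      qed
    qed (use G in auto)
    then show ?thesis by (simp add: LIMSEQ_offset)
  qed
  have aint: "\<forall>\<^sub>F k in sequentially. integrable lborel (a k)"
    using bnd
  proof eventually_elim
    case (elim k)
    show ?case
    proof (rule Bochner_Integration.integrable_bound[OF G])
      show "AE h in lborel. norm (a k h) \<le> norm (G h)"
      proof (rule AE_I2)
        fix h
        have "0 \<le> b k h" by (simp add: b_def)
        then show "norm (a k h) \<le> norm (G h)" using elim[rule_format, of h] a0[of k h] by simp
      qed
    qed simp
  qed
  \<comment> \<open>The mass of \<open>a k\<close> differs from the positive constant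
    \<open>B\<close> by at most the L1 distance, which tends to 0.\<close>
  have apos: "\<forall>\<^sub>F k in sequentially. (\<integral>h. a k h \<partial>lborel) > 0"
    using order_tendstoD(2)[OF main B] aint
  proof eventually_elim
    case (elim k)
    have "\<bar>(\<integral>h. a k h \<partial>lborel) - B\<bar> \<le> (\<integral>h. \<bar>a k h - b k h\<bar> \<partial>lborel)"
      using integral_abs_bound[of lborel "\<lambda>h. a k h - b k h"] elim(2) bint by simp
    then show ?case using elim by linarith
  qed
  show ?thesis
  proof (rule Lim_null_comparison)
    show "(\<lambda>k. 2 * (\<integral>h. \<bar>a k h - b k h\<bar> \<partial>lborel) / B) \<longlonglongrightarrow> 0"
      using tendsto_divide[OF tendsto_mult[OF tendsto_const main] tendsto_const, of B 2] B by simp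
    show "\<forall>\<^sub>F k in sequentially. norm (\<integral>h. \<bar>post_density (D k) (\<lambda>h. prior (\<beta>0 + s k *\<^sub>R h)) h - normal_dens (x k) h\<bar> \<partial>lborel)
        \<le> 2 * (\<integral>h. \<bar>a k h - b k h\<bar> \<partial>lborel) / B"
      using aint apos
    proof eventually_elim
      case (elim k)
      define c where "c = exp (- q (m k)) / prior \<beta>0"
      have c: "c > 0" using prior(4) by (simp add: c_def)
      have ac: "a k h = c * (exp (- D k h) * prior (\<beta>0 + s k *\<^sub>R h))" for h
        by (simp add: a_def pr_def c_def exp_add[symmetric] add.commute)
      have "post_density (D k) (\<lambda>h. prior (\<beta>0 + s k *\<^sub>R h)) h = a k h / (\<integral>h. a k h \<partial>lborel)" for h
        unfolding ac using c by simp
      moreover have "normal_dens (x k) h = b k h / (\<integral>h. b k h \<partial>lborel)" for h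
        by (simp add: normal_dens_eq b_def)
      ultimately show ?case
        using integral_normalised_diff_le[OF elim(1) a0 elim(2) bint(1)] B by (simp add: bint(2))
    qed
  qed
qed

text \<open>If no index \<open>k\<close> worked as \<open>N\<close>, as \<open>R\<close> and as the
  inverse tolerance at once, counterexamples for all \<open>k\<close> would form a sequence
  contradicting \<open>posterior_L1_tendsto\<close>. The thresholds precede \<open>D\<close>,
  \<open>W\<close> and \<open>x\<close>, so the statement can be applied separately at each outcome
  of a random experiment.\<close>

lemma posterior_L1_uniform:
  fixes prior :: "real^'n \<Rightarrow> real"
  assumes prior: "\<And>b. 0 \<le> prior b" "bounded (range prior)" "continuous_on UNIV prior" "prior \<beta>0 > 0"
    and e: "\<epsilon> > 0"
  shows "\<exists>\<delta>>0. \<exists>N R. \<forall>n D W x. n \<ge> N \<and> convex_on UNIV D \<and> norm W \<le> K \<and>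
      (\<forall>h. norm h \<le> R \<longrightarrow> \<bar>D h + W \<bullet> h - q h\<bar> \<le> \<delta>) \<and> (\<forall>h. D x \<le> D h) \<longrightarrow>
      (\<integral>h. \<bar>post_density D (\<lambda>h. prior (\<beta>0 + (1 / sqrt (real n)) *\<^sub>R h)) h - normal_dens x h\<bar> \<partial>lborel) < \<epsilon>"
proof -
  let ?L = "\<lambda>n D x. \<integral>h. \<bar>post_density D (\<lambda>h. prior (\<beta>0 + (1 / sqrt (real n)) *\<^sub>R h)) h - normal_dens x h\<bar> \<partial>lborel"
  let ?ok = "\<lambda>k n D W x. n \<ge> k \<and> convex_on UNIV D \<and> norm W \<le> K \<and>
    (\<forall>h. norm h \<le> real k \<longrightarrow> \<bar>D h + W \<bullet> h - q h\<bar> \<le> 1 / Suc k) \<and> (\<forall>h. D x \<le> D h)"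
  have "\<exists>k. \<forall>n D W x. ?ok k n D W x \<longrightarrow> ?L n D x < \<epsilon>"
  proof (rule ccontr)
    assume "\<not> ?thesis"
    then have ex: "\<exists>n D W x. ?ok k n D W x \<and> \<not> ?L n D x < \<epsilon>" for k by blast
    \<comment> \<open>The four objects are packed into one tuple so that a single choice yields the
      whole sequence.\<close>
    have ex2: "\<forall>k. \<exists>t. ?ok k (fst t) (fst (snd t)) (fst (snd (snd t))) (snd (snd (snd t))) \<and> \<not> ?L (fst t) (fst (snd t)) (snd (snd (snd t))) < \<epsilon>"
    proof
      fix k
      obtain n D W x where "?ok k n D W x \<and> \<not> ?L n D x < \<epsilon>" using ex[of k] by (elim exE)
      then show "\<exists>t. ?ok k (fst t) (fst (snd t)) (fst (snd (snd t))) (snd (snd (snd t))) \<and> \<not> ?L (fst t) (fst (snd t)) (snd (snd (snd t))) < \<epsilon>"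
        by (intro exI[of _ "(n, D, W, x)"], unfold fst_conv snd_conv)
    qed
    from choice[OF ex2] obtain t where
      t: "\<forall>k. ?ok k (fst (t k)) (fst (snd (t k))) (fst (snd (snd (t k)))) (snd (snd (snd (t k)))) \<and> \<not> ?L (fst (t k)) (fst (snd (t k))) (snd (snd (snd (t k)))) < \<epsilon>"
      by (elim exE)
    define n D W x where defs: "n k = fst (t k)" "D k = fst (snd (t k))" "W k = fst (snd (snd (t k)))" "x k = snd (snd (snd (t k)))" for k
    have *: "?ok k (n k) (D k) (W k) (x k)" "\<not> ?L (n k) (D k) (x k) < \<epsilon>" for k
      using t[rule_format, of k] unfolding defs by blast+
    have "filterlim n at_top sequentially"
      by (rule filterlim_at_top_mono[OF filterlim_ident]) (use * in auto)
    then have "(\<lambda>k. 1 / sqrt (real (n k))) \<longlonglongrightarrow> 0"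
      by (intro real_tendsto_divide_at_top[OF tendsto_const] filterlim_compose[OF sqrt_at_top]
          filterlim_compose[OF filterlim_real_sequentially])
    from posterior_L1_tendsto[of D W K x prior, OF _ _ _ _ prior this]
    have "(\<lambda>k. ?L (n k) (D k) (x k)) \<longlonglongrightarrow> 0" using * by blast
    then have "\<forall>\<^sub>F k in sequentially. ?L (n k) (D k) (x k) < \<epsilon>" using e by (rule order_tendstoD(2))
    then show False using *(2) by (auto simp: eventually_sequentially)
  qed
  then obtain k where "\<forall>n D W x. ?ok k n D W x \<longrightarrow> ?L n D x < \<epsilon>" by blast
  then show ?thesis by (intro exI[of _ "1 / real (Suc k)"] conjI exI[of _ k] exI[of _ "real k"]) simp_all
qed
end

section \<open>Knight's identity\<close>

text \<open>This is \<open>\<integral>\<^sub>0\<^sup>v (1\<^bsub>{z \<le> s}\<^esub> - 1\<^bsub>{z \<le> 0}\<^esub>) ds\<close>.\<close>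

definition knight_remainder :: "real \<Rightarrow> real \<Rightarrow> real" where
  "knight_remainder v z = (if 0 < z \<and> z \<le> v then v - z else if v < z \<and> z \<le> 0 then z - v else 0)"

text \<open>The linear term has coefficient \<open>\<tau> - indicator {..0} z\<close>, which is
  centred when 0 is the \<tau>-quantile of \<open>z\<close>; the curvature of the mean loss is left
  to the remainder.\<close>

lemma knight_identity:
  "check_loss \<tau> (z - v) - check_loss \<tau> z = knight_remainder v z - v * (\<tau> - indicator {..0} z)"
  by (auto simp: check_loss_def knight_remainder_def indicator_def algebra_simps)

lemma knight_remainder_bounds:
  "0 \<le> knight_remainder v z" "knight_remainder v z \<le> \<bar>v\<bar>" "\<bar>z\<bar> > \<bar>v\<bar> \<Longrightarrow> knight_remainder v z = 0"
  by (auto simp: knight_remainder_def)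

lemma knight_remainder_measurable [measurable]: "knight_remainder v \<in> borel_measurable borel"
  unfolding knight_remainder_def[abs_def] by measurable

text \<open>The graph is a right triangle with both legs \<open>\<bar>v\<bar>\<close>. Its area is
  the source of the quadratic form in the limit.\<close>

lemma has_integral_knight_remainder:
  "has_bochner_integral lborel (knight_remainder v) (v\<^sup>2 / 2)"
proof (cases "v \<ge> 0")
  case True
  have "has_bochner_integral lborel (\<lambda>z. (v - z) * indicator {0..v} z) ((v * v - v\<^sup>2 / 2) - (v * 0 - 0\<^sup>2 / 2))"
    by (rule has_bochner_integral_FTC_Icc_nonneg[where F="\<lambda>z. v * z - z\<^sup>2 / 2"])
      (use True in \<open>auto intro!: derivative_eq_intros\<close>)
  \<comment> \<open>The two sides can differ at \<open>z = 0\<close>, where the remainder is 0 for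
    nonnegative \<open>v\<close>; hence equality almost everywhere.\<close>
  moreover have "AE z in lborel. (v - z) * indicator {0..v} z = knight_remainder v z"
    using AE_lborel_singleton[of 0] by eventually_elim (use True in \<open>auto simp: knight_remainder_def indicator_def\<close>)
  ultimately have "has_bochner_integral lborel (knight_remainder v) ((v * v - v\<^sup>2 / 2) - (v * 0 - 0\<^sup>2 / 2))"
    by (subst has_bochner_integral_cong_AE[of _ _ "\<lambda>z. (v - z) * indicator {0..v} z"]) (auto elim: eventually_mono)
  then show ?thesis by (simp add: power2_eq_square)
next
  case False
  have "has_bochner_integral lborel (\<lambda>z. (z - v) * indicator {v..0} z) ((0\<^sup>2 / 2 - v * 0) - (v\<^sup>2 / 2 - v * v))"
    by (rule has_bochner_integral_FTC_Icc_nonneg[where F="\<lambda>z. z\<^sup>2 / 2 - v * z"])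
      (use False in \<open>auto intro!: derivative_eq_intros\<close>)
  moreover have "(z - v) * indicator {v..0} z = knight_remainder v z" for z
    using False by (auto simp: knight_remainder_def indicator_def)
  ultimately show ?thesis by (simp add: power2_eq_square)
qed

text \<open>With the density frozen at \<open>x\<close>, the integral is exactly
  \<open>p x * v\<^sup>2 / 2\<close>. The remainder vanishes for
  \<open>\<bar>y - x\<bar> > \<bar>v\<bar>\<close>, so freezing costs at most
  \<open>C * \<bar>v\<bar> powr \<eta>\<close> times the triangle area.\<close>

lemma (in prob_space) expectation_knight_remainder:
  fixes p :: "real \<Rightarrow> real"
  assumes Y: "distributed M lborel Y (\<lambda>y. ennreal (p y))" and p: "\<And>y. 0 \<le> p y"
    and C: "C \<ge> 0" and hoelder: "\<And>s. \<bar>s\<bar> \<le> \<bar>v\<bar> \<Longrightarrow> \<bar>p (x + s) - p x\<bar> \<le> C * \<bar>s\<bar> powr \<eta>" and eta: "\<eta> > 0"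
  shows "\<bar>expectation (\<lambda>\<omega>. knight_remainder v (Y \<omega> - x)) - p x * v\<^sup>2 / 2\<bar> \<le> C * \<bar>v\<bar> powr \<eta> * v\<^sup>2 / 2"
proof -
  have Ym[measurable]: "Y \<in> borel_measurable M" using distributed_measurable[OF Y] by simp
  have "has_bochner_integral lborel (\<lambda>y. knight_remainder v (- x + 1 * y)) ((v\<^sup>2 / 2) /\<^sub>R \<bar>1\<bar>)"
    using has_integral_knight_remainder[of v] lborel_has_bochner_integral_real_affine_iff[of 1 "knight_remainder v" "v\<^sup>2 / 2" "- x"] by simp
  then have r: "has_bochner_integral lborel (\<lambda>y. knight_remainder v (y - x)) (v\<^sup>2 / 2)" by simp
  have rint: "integrable lborel (\<lambda>y. knight_remainder v (y - x))" and ri: "(\<integral>y. knight_remainder v (y - x) \<partial>lborel) = v\<^sup>2 / 2"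
    using r by (auto simp: has_bochner_integral_iff)
  have "integrable M (\<lambda>\<omega>. knight_remainder v (Y \<omega> - x))"
    by (rule integrable_const_bound[where B="\<bar>v\<bar>"]) (auto simp: knight_remainder_bounds)
  then have pint: "integrable lborel (\<lambda>y. p y * knight_remainder v (y - x))"
    by (subst distributed_integrable[OF Y]) (auto simp: p)
  have E: "expectation (\<lambda>\<omega>. knight_remainder v (Y \<omega> - x)) = (\<integral>y. p y * knight_remainder v (y - x) \<partial>lborel)"
    by (rule distributed_integral[OF Y, symmetric]) (auto simp: p)
  have "expectation (\<lambda>\<omega>. knight_remainder v (Y \<omega> - x)) - p x * v\<^sup>2 / 2
      = (\<integral>y. p y * knight_remainder v (y - x) - p x * knight_remainder v (y - x) \<partial>lborel)"
    using pint rint by (simp add: E ri)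
  also have "\<bar>\<dots>\<bar> \<le> (\<integral>y. \<bar>p y * knight_remainder v (y - x) - p x * knight_remainder v (y - x)\<bar> \<partial>lborel)"
    by (rule integral_abs_bound)
  also have "\<dots> \<le> (\<integral>y. C * \<bar>v\<bar> powr \<eta> * knight_remainder v (y - x) \<partial>lborel)"
  proof (rule integral_mono)
    fix y
    show "\<bar>p y * knight_remainder v (y - x) - p x * knight_remainder v (y - x)\<bar> \<le> C * \<bar>v\<bar> powr \<eta> * knight_remainder v (y - x)"
    proof (cases "\<bar>y - x\<bar> \<le> \<bar>v\<bar>")
      case True
      have "\<bar>p y - p x\<bar> \<le> C * \<bar>y - x\<bar> powr \<eta>" using hoelder[OF True] by simp
      also have "\<dots> \<le> C * \<bar>v\<bar> powr \<eta>" using True C eta by (intro mult_left_mono powr_mono2) auto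
      finally have "\<bar>p y - p x\<bar> * knight_remainder v (y - x) \<le> C * \<bar>v\<bar> powr \<eta> * knight_remainder v (y - x)"
        by (intro mult_right_mono knight_remainder_bounds)
      then show ?thesis by (simp add: abs_mult knight_remainder_bounds left_diff_distrib[symmetric])
    next
      case False
      then show ?thesis by (simp add: knight_remainder_bounds(3))
    qed
  qed (use pint rint in auto)
  also have "\<dots> = C * \<bar>v\<bar> powr \<eta> * v\<^sup>2 / 2" using rint by (simp add: ri)
  finally show ?thesis .
qed

section \<open>Second moments of sums of independent bounded variables\<close>

context prob_space
begin

text \<open>Independence and centring annihilate the cross term when a summand is added; boundedness
  provides all the integrability.\<close>

lemma expectation_sum_sq_indep:
  fixes U :: "'i \<Rightarrow> 'a \<Rightarrow> real"
  assumes "finite I" "indep_vars (\<lambda>_. borel) U I"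
    and "\<And>i \<omega>. i \<in> I \<Longrightarrow> \<omega> \<in> space M \<Longrightarrow> \<bar>U i \<omega>\<bar> \<le> b" and "\<And>i. i \<in> I \<Longrightarrow> expectation (U i) = 0"
  shows "integrable M (\<lambda>\<omega>. (\<Sum>i\<in>I. U i \<omega>)\<^sup>2)"
    and "expectation (\<lambda>\<omega>. (\<Sum>i\<in>I. U i \<omega>)\<^sup>2) = (\<Sum>i\<in>I. expectation (\<lambda>\<omega>. (U i \<omega>)\<^sup>2))"
proof -
  have "integrable M (\<lambda>\<omega>. (\<Sum>i\<in>I. U i \<omega>)\<^sup>2) \<and>
    expectation (\<lambda>\<omega>. (\<Sum>i\<in>I. U i \<omega>)\<^sup>2) = (\<Sum>i\<in>I. expectation (\<lambda>\<omega>. (U i \<omega>)\<^sup>2))"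
    using assms
  proof (induction I rule: finite_induct)
    case (insert i I)
    have meas: "U j \<in> borel_measurable M" if "j \<in> insert i I" for j
      using insert.prems(1) that by (auto simp: indep_vars_def)
    have int: "integrable M (U j)" if "j \<in> insert i I" for j
      by (rule integrable_const_bound[where B=b]) (use insert.prems(2)[OF that] meas[OF that] in auto)
    have intS: "integrable M (\<lambda>\<omega>. \<Sum>j\<in>I. U j \<omega>)" using int by auto
    have ind: "indep_var borel (U i) borel (\<lambda>\<omega>. \<Sum>j\<in>I. U j \<omega>)"
      using indep_vars_sum[OF insert.hyps(1,2) insert.prems(1)] .
    have IH: "integrable M (\<lambda>\<omega>. (\<Sum>i\<in>I. U i \<omega>)\<^sup>2)"
      "expectation (\<lambda>\<omega>. (\<Sum>i\<in>I. U i \<omega>)\<^sup>2) = (\<Sum>i\<in>I. expectation (\<lambda>\<omega>. (U i \<omega>)\<^sup>2))"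
      using insert.IH[OF indep_vars_subset[OF insert.prems(1)]] insert.prems(2,3) by auto
    have sq: "integrable M (\<lambda>\<omega>. (U i \<omega>)\<^sup>2)"
    proof (rule integrable_const_bound[where B="b\<^sup>2"])
      show "AE \<omega> in M. norm ((U i \<omega>)\<^sup>2) \<le> b\<^sup>2"
        using insert.prems(2)[of i] by (auto intro!: AE_I2 simp: abs_le_square_iff[symmetric] intro: order_trans[OF _ abs_ge_self])
    qed (use meas[of i] in auto)
    have cross: "expectation (\<lambda>\<omega>. U i \<omega> * (\<Sum>j\<in>I. U j \<omega>)) = 0"
      using indep_var_lebesgue_integral[OF ind] int[of i] intS insert.prems(3)[of i] by simp
    have crossi: "integrable M (\<lambda>\<omega>. U i \<omega> * (\<Sum>j\<in>I. U j \<omega>))"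
      using indep_var_integrable[OF ind] int[of i] intS by simp
    have eq: "(\<Sum>j\<in>insert i I. U j \<omega>)\<^sup>2 = (U i \<omega>)\<^sup>2 + 2 * (U i \<omega> * (\<Sum>j\<in>I. U j \<omega>)) + (\<Sum>j\<in>I. U j \<omega>)\<^sup>2" for \<omega>
      using insert.hyps by (simp add: power2_sum)
    show ?case unfolding eq using sq cross crossi IH insert.hyps by simp
  qed simp
  then show "integrable M (\<lambda>\<omega>. (\<Sum>i\<in>I. U i \<omega>)\<^sup>2)"
    "expectation (\<lambda>\<omega>. (\<Sum>i\<in>I. U i \<omega>)\<^sup>2) = (\<Sum>i\<in>I. expectation (\<lambda>\<omega>. (U i \<omega>)\<^sup>2))" by auto
qed

lemma prob_abs_sum_indep_le:
  fixes U :: "'i \<Rightarrow> 'a \<Rightarrow> real"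
  assumes "finite I" "indep_vars (\<lambda>_. borel) U I"
    and "\<And>i \<omega>. i \<in> I \<Longrightarrow> \<omega> \<in> space M \<Longrightarrow> \<bar>U i \<omega>\<bar> \<le> b" and "\<And>i. i \<in> I \<Longrightarrow> expectation (U i) = 0"
    and "d > 0"
  shows "prob {\<omega> \<in> space M. d \<le> \<bar>\<Sum>i\<in>I. U i \<omega>\<bar>} \<le> (\<Sum>i\<in>I. expectation (\<lambda>\<omega>. (U i \<omega>)\<^sup>2)) / d\<^sup>2"
proof -
  have [measurable]: "(\<lambda>\<omega>. \<Sum>i\<in>I. U i \<omega>) \<in> borel_measurable M"
    using assms(2) by (intro borel_measurable_sum) (auto simp: indep_vars_def)
  show ?thesis
    using second_moment_method[of "\<lambda>\<omega>. \<Sum>i\<in>I. U i \<omega>" d] expectation_sum_sq_indep[OF assms(1-4)] assms(5) by simp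
qed

end

section \<open>Bilinear forms of averaged outer products\<close>

lemma outer_square_mult_vec: "outer_square x *v h = (x \<bullet> h) *\<^sub>R x"
  by (simp add: vec_eq_iff outer_square_def matrix_vector_mult_def inner_vec_def sum_distrib_left sum_distrib_right mult_ac)

lemma tendsto_bilinear_matrix:
  fixes A :: "nat \<Rightarrow> real^'n^'n"
  assumes "A \<longlonglongrightarrow> V"
  shows "(\<lambda>n. x \<bullet> (A n *v y)) \<longlonglongrightarrow> x \<bullet> (V *v y)"
proof -
  have "x \<bullet> (B *v y) = (\<Sum>i\<in>UNIV. x $ i * (\<Sum>j\<in>UNIV. B $ i $ j * y $ j))" for B :: "real^'n^'n"
    by (simp add: inner_vec_def matrix_vector_mult_def)
  moreover have "(\<lambda>n. \<Sum>i\<in>UNIV. x $ i * (\<Sum>j\<in>UNIV. A n $ i $ j * y $ j))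
      \<longlonglongrightarrow> (\<Sum>i\<in>UNIV. x $ i * (\<Sum>j\<in>UNIV. V $ i $ j * y $ j))"
    by (intro tendsto_sum tendsto_mult tendsto_const tendsto_vec_nth assms)
  ultimately show ?thesis by simp
qed

lemma bilinear_mean_outer_square:
  "x \<bullet> ((c *\<^sub>R (\<Sum>i\<in>I. w i *\<^sub>R outer_square (X i))) *v y) = c * (\<Sum>i\<in>I. w i * (X i \<bullet> x) * (X i \<bullet> y))"
proof -
  have "(\<Sum>i\<in>I. w i *\<^sub>R outer_square (X i)) *v y = (\<Sum>i\<in>I. (w i * (X i \<bullet> y)) *\<^sub>R X i)"
    by (induction I rule: infinite_finite_induct)
      (simp_all add: matrix_vector_mult_add_rdistrib scaleR_matrix_vector_assoc[symmetric] outer_square_mult_vec)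
  then show ?thesis
    by (simp add: scaleR_matrix_vector_assoc[symmetric] inner_sum_right inner_commute mult_ac)
qed

section \<open>The quantile regression loss\<close>

text \<open>\<open>hoelder\<close> concerns scalar shifts of the linear predictor, since the
  expected Knight remainder is an integral over the scalar response.\<close>

locale quantile_model = prob_space M for M :: "'a measure" +
  fixes Y :: "nat \<Rightarrow> 'a \<Rightarrow> real" and p :: "nat \<Rightarrow> real \<Rightarrow> real" and X :: "nat \<Rightarrow> real^'p"
    and \<beta>0 :: "real^'p" and \<tau> :: real and V :: "real^'p^'p" and K C d \<eta> :: real
  assumes tau: "0 < \<tau>" "\<tau> < 1"
    and indep: "indep_vars (\<lambda>_. borel) Y {1..}"
    and p_nonneg: "\<And>i y. i \<ge> 1 \<Longrightarrow> 0 \<le> p i y"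
    and pdf: "\<And>i. i \<ge> 1 \<Longrightarrow> distributed M lborel (Y i) (\<lambda>y. ennreal (p i y))"
    and quantile: "\<And>i. i \<ge> 1 \<Longrightarrow> prob {\<omega> \<in> space M. Y i \<omega> - X i \<bullet> \<beta>0 \<le> 0} = \<tau>"
    and V_lim: "(\<lambda>n. (1 / real n) *\<^sub>R (\<Sum>i=1..n. p i (X i \<bullet> \<beta>0) *\<^sub>R outer_square (X i))) \<longlonglongrightarrow> V"
    and X_bound: "\<And>i. i \<ge> 1 \<Longrightarrow> norm (X i) \<le> K"
    and hoelder: "\<And>i s. i \<ge> 1 \<Longrightarrow> \<bar>s\<bar> \<le> d \<Longrightarrow> \<bar>p i (X i \<bullet> \<beta>0 + s) - p i (X i \<bullet> \<beta>0)\<bar> \<le> C * \<bar>s\<bar> powr \<eta>"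
    and d: "d > 0" and C: "C \<ge> 0" and eta: "\<eta> > 0"
begin

text \<open>This is \<open>W\<^sub>n\<close>; the next two definitions are \<open>D\<^sub>n\<close>
  and \<open>R\<^sub>n\<close>.\<close>

definition score :: "nat \<Rightarrow> 'a \<Rightarrow> real^'p" where
  "score n \<omega> = (1 / sqrt (real n)) *\<^sub>R (\<Sum>i=1..n. (\<tau> - indicator {..0} (Y i \<omega> - X i \<bullet> \<beta>0)) *\<^sub>R X i)"

definition excess_loss :: "nat \<Rightarrow> 'a \<Rightarrow> real^'p \<Rightarrow> real" where
  "excess_loss n \<omega> h = (\<Sum>i=1..n. check_loss \<tau> (Y i \<omega> - X i \<bullet> (\<beta>0 + (1 / sqrt (real n)) *\<^sub>R h))
     - check_loss \<tau> (Y i \<omega> - X i \<bullet> \<beta>0))"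

definition remainder :: "nat \<Rightarrow> real^'p \<Rightarrow> 'a \<Rightarrow> real" where
  "remainder n h \<omega> = (\<Sum>i=1..n. knight_remainder (X i \<bullet> h / sqrt (real n)) (Y i \<omega> - X i \<bullet> \<beta>0))"

lemma excess_loss_eq: "excess_loss n \<omega> h + score n \<omega> \<bullet> h = remainder n h \<omega>"
proof -
  have *: "Y i \<omega> - X i \<bullet> (\<beta>0 + (1 / sqrt (real n)) *\<^sub>R h) = Y i \<omega> - X i \<bullet> \<beta>0 - X i \<bullet> h / sqrt (real n)" for i
    by (simp add: inner_add_right)
  show ?thesis
    unfolding excess_loss_def * knight_identity score_def remainder_def
    by (simp add: inner_sum_left sum_distrib_left sum_subtractf mult_ac)
qed

lemma Y_measurable: "i \<ge> 1 \<Longrightarrow> Y i \<in> borel_measurable M"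
  using distributed_measurable[OF pdf] by simp

lemma score_measurable: "score n \<in> borel_measurable M"
  unfolding score_def by (intro borel_measurable_scaleR borel_measurable_sum borel_measurable_const borel_measurable_diff measurable_compose[OF borel_measurable_diff[OF Y_measurable borel_measurable_const]] borel_measurable_indicator) auto

lemma remainder_measurable: "remainder n h \<in> borel_measurable M"
  unfolding remainder_def
  by (intro borel_measurable_sum measurable_compose[OF borel_measurable_diff[OF Y_measurable borel_measurable_const]] knight_remainder_measurable) auto

lemma K_nonneg: "K \<ge> 0"
  using X_bound[of 1] norm_ge_zero[of "X 1"] by linarith

text \<open>Chebyshev: \<open>n\<close> centred summands bounded by \<open>K / sqrt n\<close> have
  total second moment at most \<open>K\<^sup>2\<close>, whatever \<open>n\<close> is.\<close>

lemma prob_score_component: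
  assumes c: "c > 0"
  shows "prob {\<omega> \<in> space M. c \<le> \<bar>score n \<omega> $ k\<bar>} \<le> K\<^sup>2 / c\<^sup>2"
proof (cases "n = 0")
  case True
  then show ?thesis using c by (simp add: score_def)
next
  case False
  define U where "U i \<omega> = (\<tau> - indicator {..0} (Y i \<omega> - X i \<bullet> \<beta>0)) * (X i $ k / sqrt (real n))" for i \<omega>
  have score: "score n \<omega> $ k = (\<Sum>i=1..n. U i \<omega>)" for \<omega>
    by (simp add: score_def U_def sum_distrib_left mult_ac)
  have Xk: "\<bar>X i $ k\<bar> \<le> K" if "i \<in> {1..n}" for i
    using component_le_norm_cart[of "X i" k] X_bound[of i] that by simp
  have sgn: "\<bar>\<tau> - indicator {..0} z\<bar> \<le> 1" for z :: real using tau by (auto simp: indicator_def)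
  have sn: "sqrt (real n) \<ge> 1" using False by simp
  have Ub: "\<bar>U i \<omega>\<bar> \<le> K / sqrt (real n)" if "i \<in> {1..n}" for i \<omega>
  proof -
    have "\<bar>U i \<omega>\<bar> = \<bar>\<tau> - indicator {..0} (Y i \<omega> - X i \<bullet> \<beta>0)\<bar> * (\<bar>X i $ k\<bar> / sqrt (real n))"
      by (simp add: U_def abs_mult)
    also have "\<dots> \<le> 1 * (K / sqrt (real n))"
      using sgn Xk[OF that] by (intro mult_mono divide_right_mono) auto
    finally show ?thesis by simp
  qed
  have ind: "indep_vars (\<lambda>_. borel) U {1..n}"
    unfolding U_def
    by (rule indep_vars_compose2[OF indep_vars_subset[OF indep], where Y="\<lambda>i y. (\<tau> - indicator {..0} (y - X i \<bullet> \<beta>0)) * (X i $ k / sqrt (real n))"]) auto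
  have Um: "U i \<in> borel_measurable M" if "i \<in> {1..n}" for i
    using ind that by (auto simp: indep_vars_def)
  have EU: "expectation (U i) = 0" if i: "i \<in> {1..n}" for i
  proof -
    have [measurable]: "Y i \<in> borel_measurable M" using Y_measurable i by simp
    let ?A = "{\<omega> \<in> space M. Y i \<omega> - X i \<bullet> \<beta>0 \<le> 0}"
    have A: "?A \<in> events" by measurable
    have "expectation (\<lambda>\<omega>. \<tau> - indicator {..0} (Y i \<omega> - X i \<bullet> \<beta>0)) = expectation (\<lambda>\<omega>. \<tau> - indicator ?A \<omega>)"
      by (rule Bochner_Integration.integral_cong) (auto simp: indicator_def)
    also have "\<dots> = \<tau> - prob ?A"
      using A by (subst Bochner_Integration.integral_diff) (auto simp: prob_space less_top[symmetric])
    finally show ?thesis using quantile[of i] i by (simp add: U_def[abs_def])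
  qed
  have "prob {\<omega> \<in> space M. c \<le> \<bar>\<Sum>i=1..n. U i \<omega>\<bar>} \<le> (\<Sum>i=1..n. expectation (\<lambda>\<omega>. (U i \<omega>)\<^sup>2)) / c\<^sup>2"
    using prob_abs_sum_indep_le[OF _ ind Ub EU c] by simp
  also have "\<dots> \<le> (\<Sum>i=1..n. (K / sqrt (real n))\<^sup>2) / c\<^sup>2"
  proof (intro divide_right_mono sum_mono)
    fix i assume i: "i \<in> {1..n}"
    have sq: "(U i \<omega>)\<^sup>2 \<le> (K / sqrt (real n))\<^sup>2" for \<omega>
      using Ub[OF i, of \<omega>] by (meson abs_le_square_iff abs_ge_self order_trans)
    have "expectation (\<lambda>\<omega>. (U i \<omega>)\<^sup>2) \<le> expectation (\<lambda>\<omega>. (K / sqrt (real n))\<^sup>2)"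
    proof (rule integral_mono)
      show "integrable M (\<lambda>\<omega>. (U i \<omega>)\<^sup>2)"
        by (rule integrable_const_bound[where B="(K / sqrt (real n))\<^sup>2"]) (use sq Um[OF i] in auto)
    qed (use sq in auto)
    then show "expectation (\<lambda>\<omega>. (U i \<omega>)\<^sup>2) \<le> (K / sqrt (real n))\<^sup>2" by (simp add: prob_space)
  qed simp
  also have "\<dots> = K\<^sup>2 / c\<^sup>2" using False by (simp add: power_divide)
  finally show ?thesis by (simp add: score)
qed

lemma score_tight:
  assumes "\<epsilon> > 0"
  obtains R where "\<And>n. prob {\<omega> \<in> space M. norm (score n \<omega>) > R} \<le> \<epsilon>"
proof
  \<comment> \<open>A norm above \<open>CARD('p) * c\<close> forces some component to reach
    \<open>c\<close>, so \<open>c\<close> must satisfy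
    \<open>CARD('p) * K\<^sup>2 / c\<^sup>2 \<le> \<epsilon>\<close>. Adding 1 keeps
    \<open>c\<close> positive even for \<open>K = 0\<close>.\<close>
  define c where "c = sqrt (CARD('p) * K\<^sup>2 / \<epsilon>) + 1"
  have c0: "c > 0" using assms by (auto simp: c_def intro: add_nonneg_pos)
  have "CARD('p) * K\<^sup>2 / \<epsilon> = (sqrt (CARD('p) * K\<^sup>2 / \<epsilon>))\<^sup>2" using assms by simp
  also have "\<dots> \<le> c\<^sup>2" using assms by (intro power_mono) (auto simp: c_def)
  finally have cb: "CARD('p) * (K\<^sup>2 / c\<^sup>2) \<le> \<epsilon>" using assms c0 by (simp add: field_simps)
  fix n
  have [measurable]: "score n \<in> borel_measurable M" by (rule score_measurable)
  have "{\<omega> \<in> space M. norm (score n \<omega>) > CARD('p) * c} \<subseteq> (\<Union>k. {\<omega> \<in> space M. c \<le> \<bar>score n \<omega> $ k\<bar>})"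
  proof (rule ccontr)
    assume "\<not> ?thesis"
    then obtain \<omega> where 1: "norm (score n \<omega>) > CARD('p) * c" and 2: "\<forall>k. \<not> c \<le> \<bar>score n \<omega> $ k\<bar>"
      by (auto simp: subset_iff)
    have "norm (score n \<omega>) \<le> (\<Sum>k\<in>UNIV. \<bar>score n \<omega> $ k\<bar>)" by (rule norm_le_l1_cart)
    also have "\<dots> \<le> (\<Sum>k\<in>(UNIV::'p set). c)" using 2 by (intro sum_mono) (simp add: less_imp_le not_le)
    finally show False using 1 by simp
  qed
  then have "prob {\<omega> \<in> space M. norm (score n \<omega>) > CARD('p) * c} \<le> prob (\<Union>k. {\<omega> \<in> space M. c \<le> \<bar>score n \<omega> $ k\<bar>})"
    by (intro finite_measure_mono) auto
  also have "\<dots> \<le> (\<Sum>k\<in>UNIV. prob {\<omega> \<in> space M. c \<le> \<bar>score n \<omega> $ k\<bar>})"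
    by (intro finite_measure_subadditive_finite) auto
  also have "\<dots> \<le> (\<Sum>k\<in>(UNIV::'p set). K\<^sup>2 / c\<^sup>2)"
    by (intro sum_mono prob_score_component c0)
  also have "\<dots> \<le> \<epsilon>" using cb by simp
  finally show "prob {\<omega> \<in> space M. norm (score n \<omega>) > CARD('p) * c} \<le> \<epsilon>" .
qed

lemma expectation_remainder_tendsto:
  "(\<lambda>n. \<Sum>i=1..n. expectation (\<lambda>\<omega>. knight_remainder (X i \<bullet> h / sqrt (real n)) (Y i \<omega> - X i \<bullet> \<beta>0)))
    \<longlonglongrightarrow> h \<bullet> (V *v h) / 2"
proof -
  let ?E = "\<lambda>n i. expectation (\<lambda>\<omega>. knight_remainder (X i \<bullet> h / sqrt (real n)) (Y i \<omega> - X i \<bullet> \<beta>0))"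
  define t where "t n = K * norm h / sqrt (real n)" for n
  have t0: "t \<longlonglongrightarrow> 0"
    unfolding t_def by (intro real_tendsto_divide_at_top[OF tendsto_const] filterlim_compose[OF sqrt_at_top]
        filterlim_real_sequentially)
  have tn: "0 \<le> t n" for n using K_nonneg by (simp add: t_def)
  define Q where "Q n = (1 / real n) * (\<Sum>i=1..n. p i (X i \<bullet> \<beta>0) * (X i \<bullet> h) * (X i \<bullet> h))" for n
  have Q: "Q \<longlonglongrightarrow> h \<bullet> (V *v h)"
    using tendsto_bilinear_matrix[OF V_lim, of h h] unfolding bilinear_mean_outer_square Q_def .
  have "(\<lambda>n. (\<Sum>i=1..n. ?E n i) - Q n / 2) \<longlonglongrightarrow> 0"
  proof (rule Lim_null_comparison)
    have "(\<lambda>n. t n powr \<eta>) \<longlonglongrightarrow> 0 powr \<eta>"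
      by (rule tendsto_powr'[OF t0 tendsto_const]) (use tn eta in auto)
    then have "(\<lambda>n. C * t n powr \<eta> * (K * norm h)\<^sup>2 / 2) \<longlonglongrightarrow> C * 0 powr \<eta> * (K * norm h)\<^sup>2 / 2"
      by (intro tendsto_divide tendsto_mult tendsto_const) auto
    then show "(\<lambda>n. C * t n powr \<eta> * (K * norm h)\<^sup>2 / 2) \<longlonglongrightarrow> 0" by simp
    show "\<forall>\<^sub>F n in sequentially. norm ((\<Sum>i=1..n. ?E n i) - Q n / 2) \<le> C * t n powr \<eta> * (K * norm h)\<^sup>2 / 2"
      using order_tendstoD(2)[OF t0 d] eventually_gt_at_top[of 0]
    proof eventually_elim
      case (elim n)
      have v: "\<bar>X i \<bullet> h / sqrt (real n)\<bar> \<le> t n" if "i \<in> {1..n}" for i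
      proof -
        have "\<bar>X i \<bullet> h\<bar> \<le> norm (X i) * norm h" by (rule Cauchy_Schwarz_ineq2)
        also have "\<dots> \<le> K * norm h" using X_bound that by (intro mult_right_mono) auto
        finally show ?thesis by (simp add: t_def divide_right_mono)
      qed
      have "Q n / 2 = (\<Sum>i=1..n. p i (X i \<bullet> \<beta>0) * (X i \<bullet> h / sqrt (real n))\<^sup>2 / 2)"
        unfolding Q_def sum_distrib_left sum_divide_distrib
        by (intro sum.cong) (use elim in \<open>auto simp: power_divide power2_eq_square\<close>)
      then have "norm ((\<Sum>i=1..n. ?E n i) - Q n / 2) = \<bar>\<Sum>i=1..n. ?E n i - p i (X i \<bullet> \<beta>0) * (X i \<bullet> h / sqrt (real n))\<^sup>2 / 2\<bar>"
        by (simp add: sum_subtractf)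
      also have "\<dots> \<le> (\<Sum>i=1..n. \<bar>?E n i - p i (X i \<bullet> \<beta>0) * (X i \<bullet> h / sqrt (real n))\<^sup>2 / 2\<bar>)"
        by (rule sum_abs)
      also have "\<dots> \<le> (\<Sum>i=1..n. C * t n powr \<eta> * (t n)\<^sup>2 / 2)"
      proof (rule sum_mono)
        fix i assume i: "i \<in> {1..n}"
        have "\<bar>?E n i - p i (X i \<bullet> \<beta>0) * (X i \<bullet> h / sqrt (real n))\<^sup>2 / 2\<bar>
            \<le> C * \<bar>X i \<bullet> h / sqrt (real n)\<bar> powr \<eta> * (X i \<bullet> h / sqrt (real n))\<^sup>2 / 2"
        proof (rule expectation_knight_remainder[OF pdf _ C _ eta])
          fix s assume "\<bar>s\<bar> \<le> \<bar>X i \<bullet> h / sqrt (real n)\<bar>"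
          then show "\<bar>p i (X i \<bullet> \<beta>0 + s) - p i (X i \<bullet> \<beta>0)\<bar> \<le> C * \<bar>s\<bar> powr \<eta>"
            using hoelder[of i s] v[OF i] elim(1) i by simp
        qed (use i p_nonneg in auto)
        also have "\<dots> \<le> C * t n powr \<eta> * (t n)\<^sup>2 / 2"
        proof (intro divide_right_mono mult_mono mult_left_mono powr_mono2)
          show "(X i \<bullet> h / sqrt (real n))\<^sup>2 \<le> (t n)\<^sup>2"
            using power_mono[OF v[OF i] abs_ge_zero, of 2] by (simp only: power2_abs)
        qed (use v[OF i] C eta tn in auto)
        finally show "\<bar>?E n i - p i (X i \<bullet> \<beta>0) * (X i \<bullet> h / sqrt (real n))\<^sup>2 / 2\<bar> \<le> C * t n powr \<eta> * (t n)\<^sup>2 / 2" .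
      qed
      also have "\<dots> = C * t n powr \<eta> * (K * norm h)\<^sup>2 / 2"
        using elim(2) by (simp add: t_def power_divide)
      finally show ?case .
    qed
  qed
  from tendsto_add[OF this tendsto_divide[OF Q tendsto_const[of 2]]] show ?thesis by simp
qed

text \<open>Each summand lies between 0 and \<open>t n\<close>, so its variance is at most
  \<open>t n\<close> times its mean. The total variance is thus at most \<open>t n * m n\<close>, a
  null sequence times a convergent one.\<close>

lemma remainder_tendsto_in_prob:
  assumes \<delta>: "\<delta> > 0"
  shows "(\<lambda>n. prob {\<omega> \<in> space M. \<bar>remainder n h \<omega> - h \<bullet> (V *v h) / 2\<bar> > \<delta>}) \<longlonglongrightarrow> 0"
proof -
  let ?r = "\<lambda>n i \<omega>. knight_remainder (X i \<bullet> h / sqrt (real n)) (Y i \<omega> - X i \<bullet> \<beta>0)"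
  define m where "m n = (\<Sum>i=1..n. expectation (?r n i))" for n
  have m: "m \<longlonglongrightarrow> h \<bullet> (V *v h) / 2" unfolding m_def by (rule expectation_remainder_tendsto)
  define t where "t n = K * norm h / sqrt (real n)" for n
  have t0: "t \<longlonglongrightarrow> 0"
    unfolding t_def by (intro real_tendsto_divide_at_top[OF tendsto_const] filterlim_compose[OF sqrt_at_top]
        filterlim_real_sequentially)
  show ?thesis
  proof (rule tendsto_sandwich[OF _ _ tendsto_const])
    show "\<forall>\<^sub>F n in sequentially. 0 \<le> prob {\<omega> \<in> space M. \<bar>remainder n h \<omega> - h \<bullet> (V *v h) / 2\<bar> > \<delta>}" by simp
    have "(\<lambda>n. t n * m n / (\<delta> / 2)\<^sup>2) \<longlonglongrightarrow> 0 * (h \<bullet> (V *v h) / 2) / (\<delta> / 2)\<^sup>2"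
      by (intro tendsto_intros t0 m) (use \<delta> in auto)
    then show "(\<lambda>n. t n * m n / (\<delta> / 2)\<^sup>2) \<longlonglongrightarrow> 0" by simp
    \<comment> \<open>Half of \<open>\<delta>\<close> pays for the bias of the mean
      \<open>m n\<close>, the other half for the fluctuation around it.\<close>
    have "\<forall>\<^sub>F n in sequentially. dist (m n) (h \<bullet> (V *v h) / 2) < \<delta> / 2"
      using tendstoD[OF m, of "\<delta> / 2"] \<delta> by simp
    then show "\<forall>\<^sub>F n in sequentially. prob {\<omega> \<in> space M. \<bar>remainder n h \<omega> - h \<bullet> (V *v h) / 2\<bar> > \<delta>} \<le> t n * m n / (\<delta> / 2)\<^sup>2"
      using eventually_gt_at_top[of 0]
    proof eventually_elim
      case (elim n)
      have v: "\<bar>X i \<bullet> h / sqrt (real n)\<bar> \<le> t n" if "i \<in> {1..n}" for i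
      proof -
        have "\<bar>X i \<bullet> h\<bar> \<le> norm (X i) * norm h" by (rule Cauchy_Schwarz_ineq2)
        also have "\<dots> \<le> K * norm h" using X_bound that by (intro mult_right_mono) auto
        finally show ?thesis by (simp add: t_def divide_right_mono)
      qed
      have rb: "0 \<le> ?r n i \<omega>" "?r n i \<omega> \<le> t n" if "i \<in> {1..n}" for i \<omega>
        using knight_remainder_bounds(1,2) v[OF that] order_trans by blast+
      have rm: "?r n i \<in> borel_measurable M" if "i \<in> {1..n}" for i
        by (rule measurable_compose[OF borel_measurable_diff[OF Y_measurable borel_measurable_const] knight_remainder_measurable]) (use that in auto)
      have ri: "integrable M (?r n i)" if "i \<in> {1..n}" for i
        by (rule integrable_const_bound[where B="t n"]) (use rb[OF that] rm[OF that] in auto)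
      have ri2: "integrable M (\<lambda>\<omega>. (?r n i \<omega>)\<^sup>2)" if "i \<in> {1..n}" for i
        by (rule integrable_const_bound[where B="(t n)\<^sup>2"]) (use rb[OF that] rm[OF that] in \<open>auto intro!: power_mono\<close>)
      have Er: "0 \<le> expectation (?r n i)" "expectation (?r n i) \<le> t n" if "i \<in> {1..n}" for i
      proof -
        show "0 \<le> expectation (?r n i)" by (rule Bochner_Integration.integral_nonneg) (use rb that in auto)
        have "expectation (?r n i) \<le> expectation (\<lambda>_. t n)"
          by (rule integral_mono[OF ri[OF that]]) (use rb that in auto)
        then show "expectation (?r n i) \<le> t n" by (simp add: prob_space)
      qed
      define U where "U i \<omega> = ?r n i \<omega> - expectation (?r n i)" for i \<omega>
      have ind: "indep_vars (\<lambda>_. borel) U {1..n}"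
        unfolding U_def
        by (rule indep_vars_compose2[OF indep_vars_subset[OF indep], where Y="\<lambda>i y. knight_remainder (X i \<bullet> h / sqrt (real n)) (y - X i \<bullet> \<beta>0) - expectation (?r n i)"]) auto
      have Ub: "\<bar>U i \<omega>\<bar> \<le> t n" if "i \<in> {1..n}" for i \<omega>
        using rb[OF that, of \<omega>] Er[OF that] by (simp add: U_def abs_le_iff)
      have EU: "expectation (U i) = 0" if "i \<in> {1..n}" for i
        unfolding U_def using ri[OF that] by (simp add: prob_space)
      have EU2: "expectation (\<lambda>\<omega>. (U i \<omega>)\<^sup>2) \<le> t n * expectation (?r n i)" if i: "i \<in> {1..n}" for i
      proof -
        have "expectation (\<lambda>\<omega>. (U i \<omega>)\<^sup>2) \<le> expectation (\<lambda>\<omega>. (?r n i \<omega>)\<^sup>2)"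
          unfolding U_def using variance_eq[OF ri[OF i] ri2[OF i]] by simp
        also have "\<dots> \<le> expectation (\<lambda>\<omega>. t n * ?r n i \<omega>)"
          by (rule integral_mono[OF ri2[OF i]]) (use ri[OF i] rb[OF i] in \<open>auto simp: power2_eq_square intro!: mult_right_mono\<close>)
        finally show ?thesis using ri[OF i] by simp
      qed
      have sumU: "(\<Sum>i=1..n. U i \<omega>) = remainder n h \<omega> - m n" for \<omega>
        by (simp add: U_def remainder_def m_def sum_subtractf)
      have [measurable]: "remainder n h \<in> borel_measurable M" by (rule remainder_measurable)
      have "prob {\<omega> \<in> space M. \<bar>remainder n h \<omega> - h \<bullet> (V *v h) / 2\<bar> > \<delta>}
          \<le> prob {\<omega> \<in> space M. \<delta> / 2 \<le> \<bar>\<Sum>i=1..n. U i \<omega>\<bar>}"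
        unfolding sumU
      proof (rule finite_measure_mono)
        show "{\<omega> \<in> space M. \<bar>remainder n h \<omega> - h \<bullet> (V *v h) / 2\<bar> > \<delta>} \<subseteq> {\<omega> \<in> space M. \<delta> / 2 \<le> \<bar>remainder n h \<omega> - m n\<bar>}"
        proof safe
          fix \<omega> assume "\<bar>remainder n h \<omega> - h \<bullet> (V *v h) / 2\<bar> > \<delta>"
          then show "\<delta> / 2 \<le> \<bar>remainder n h \<omega> - m n\<bar>"
            using elim(1) unfolding dist_real_def by linarith
        qed
      qed measurable
      also have "\<dots> \<le> (\<Sum>i=1..n. expectation (\<lambda>\<omega>. (U i \<omega>)\<^sup>2)) / (\<delta> / 2)\<^sup>2"
        using prob_abs_sum_indep_le[OF _ ind Ub EU, of "\<delta> / 2"] \<delta> by simp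
      also have "\<dots> \<le> t n * m n / (\<delta> / 2)\<^sup>2"
        unfolding m_def sum_distrib_left using EU2 by (intro divide_right_mono sum_mono) auto
      finally show ?case .
    qed
  qed
qed

end

section \<open>Positive definiteness of the limit matrix\<close>

text \<open>A limit of averages of \<open>outer_square\<close> with nonnegative weights is symmetric
  and positive semidefinite. A null vector of such a form lies in the kernel of \<open>V\<close>, so
  invertibility makes it definite; compactness of the sphere then yields
  \<open>\<kappa>\<close>.\<close>

lemma positive_definite_limit:
  fixes V :: "real^'p^'p"
  assumes lim: "(\<lambda>n. (1 / real n) *\<^sub>R (\<Sum>i=1..n. w i *\<^sub>R outer_square (X i))) \<longlonglongrightarrow> V"
    and w: "\<And>i. i \<ge> 1 \<Longrightarrow> w i \<ge> 0" and inv: "invertible V"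
  obtains \<kappa> where "pos_def V \<kappa>"
proof -
  have sym: "x \<bullet> (V *v y) = y \<bullet> (V *v x)" for x y
  proof (rule LIMSEQ_unique[OF tendsto_bilinear_matrix[OF lim]])
    show "(\<lambda>n. x \<bullet> ((1 / real n) *\<^sub>R (\<Sum>i=1..n. w i *\<^sub>R outer_square (X i)) *v y)) \<longlonglongrightarrow> y \<bullet> (V *v x)"
      using tendsto_bilinear_matrix[OF lim, of y x] unfolding bilinear_mean_outer_square by (simp add: mult_ac)
  qed
  have nn: "0 \<le> x \<bullet> (V *v x)" for x
  proof (rule LIMSEQ_le_const[OF tendsto_bilinear_matrix[OF lim]])
    show "\<exists>N. \<forall>n\<ge>N. 0 \<le> x \<bullet> ((1 / real n) *\<^sub>R (\<Sum>i=1..n. w i *\<^sub>R outer_square (X i)) *v x)"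
      unfolding bilinear_mean_outer_square mult.assoc
      by (intro exI[of _ 0] allI impI mult_nonneg_nonneg[OF _ sum_nonneg]) (auto intro!: mult_nonneg_nonneg[OF w])
  qed
  have pos: "x \<bullet> (V *v x) > 0" if "x \<noteq> 0" for x
  proof (rule ccontr)
    assume "\<not> ?thesis"
    then have x0: "x \<bullet> (V *v x) = 0" using nn[of x] by simp
    let ?y = "V *v x"
    let ?a = "?y \<bullet> ?y" and ?b = "?y \<bullet> (V *v ?y)"
    \<comment> \<open>This \<open>t\<close> ensures \<open>t * ?b \<le> ?a\<close>, so the form at
      \<open>x - t *\<^sub>R ?y\<close> is at most \<open>- t * ?a\<close>, which would be negative
      unless \<open>V *v x = 0\<close>. The 1 in the denominator covers
      \<open>?b = 0\<close>.\<close>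
    define t where "t = ?a / (?b + 1)"
    have b: "?b \<ge> 0" by (rule nn)
    have "0 \<le> (x - t *\<^sub>R ?y) \<bullet> (V *v (x - t *\<^sub>R ?y))" by (rule nn)
    also have "\<dots> = t * (t * ?b - 2 * ?a)"
      using x0 sym[of x ?y]
      by (simp add: matrix_vector_mult_diff_distrib matrix_vector_mult_scaleR inner_diff_left inner_diff_right algebra_simps)
    finally have "0 \<le> t * (t * ?b - 2 * ?a)" .
    moreover have "t * ?b \<le> ?a" using b by (simp add: t_def field_simps)
    moreover have "?a > 0 \<Longrightarrow> t > 0" using b by (simp add: t_def)
    ultimately have "\<not> ?a > 0" by (smt (verit) mult_pos_neg)
    then have "V *v x = 0" by simp
    then have "x = matrix_inv V *v 0" using matrix_inv_cancel(4)[OF inv, of x] by metis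
    then have "x = 0" by simp
    with that show False by contradiction
  qed
  have cont: "continuous_on (sphere 0 1) (\<lambda>x. x \<bullet> (V *v x))"
    by (intro continuous_on_inner continuous_on_id linear_continuous_on matrix_vector_mul_bounded_linear)
  have "sphere (0::real^'p) 1 \<noteq> {}" by simp
  then obtain x0 where x0: "x0 \<in> sphere 0 1" "\<And>x. x \<in> sphere 0 1 \<Longrightarrow> x0 \<bullet> (V *v x0) \<le> x \<bullet> (V *v x)"
    using continuous_attains_inf[OF compact_sphere _ cont] by blast
  let ?k = "x0 \<bullet> (V *v x0)"
  have "?k * (norm x)\<^sup>2 \<le> x \<bullet> (V *v x)" for x
  proof (cases "x = 0")
    case False
    let ?u = "x /\<^sub>R norm x"
    have "?k \<le> ?u \<bullet> (V *v ?u)" using False by (intro x0(2)) simp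
    also have "\<dots> = (x \<bullet> (V *v x)) / (norm x)\<^sup>2"
      using False by (simp add: matrix_vector_mult_scaleR power2_eq_square field_simps)
    finally show ?thesis using False by (simp add: field_simps)
  qed simp
  moreover have "?k > 0" using x0(1) by (intro pos) auto
  ultimately have "pos_def V ?k" by (intro pos_def.intro inv sym)
  then show ?thesis using that by blast
qed

section \<open>The posterior density of the local parameter\<close>

lemma integral_lborel_scale_translate:
  fixes F :: "'a::euclidean_space \<Rightarrow> real"
  assumes [measurable]: "F \<in> borel_measurable borel" and c: "c \<noteq> 0"
  shows "(\<integral>x. F x \<partial>lborel) = \<bar>c\<bar> ^ DIM('a) * (\<integral>x. F (t + c *\<^sub>R x) \<partial>lborel)"
    and "integrable lborel F \<Longrightarrow> integrable lborel (\<lambda>x. F (t + c *\<^sub>R x))"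
proof -
  let ?D = "density (distr lborel borel (\<lambda>x::'a. t + c *\<^sub>R x)) (\<lambda>_. ennreal (\<bar>c\<bar> ^ DIM('a)))"
  have D: "lborel = ?D" using lborel_affine[OF c, of t] by (simp add: ennreal_power)
  have "(\<integral>x. F x \<partial>lborel) = (\<integral>x. F x \<partial>?D)" by (subst D) (rule refl)
  also have "\<dots> = \<bar>c\<bar> ^ DIM('a) * (\<integral>x. F (t + c *\<^sub>R x) \<partial>lborel)"
    by (subst integral_real_density) (auto simp: integral_distr)
  finally show "(\<integral>x. F x \<partial>lborel) = \<bar>c\<bar> ^ DIM('a) * (\<integral>x. F (t + c *\<^sub>R x) \<partial>lborel)" .
  assume "integrable lborel F"
  then have "integrable ?D F" by (subst (asm) D)
  then have "integrable lborel (\<lambda>x. \<bar>c\<bar> ^ DIM('a) * F (t + c *\<^sub>R x))"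
    by (subst (asm) integrable_real_density) (auto simp: integrable_distr_eq)
  then show "integrable lborel (\<lambda>x. F (t + c *\<^sub>R x))" using c by simp
qed

text \<open>As a maximum of two linear functions the check loss is convex, which is the source of
  every convexity claim about the likelihood.\<close>

lemma check_loss_eq_max: "0 < \<tau> \<Longrightarrow> \<tau> < 1 \<Longrightarrow> check_loss \<tau> u = max (\<tau> * u) ((\<tau> - 1) * u)"
  by (cases "u \<le> 0") (auto simp: check_loss_def indicator_def max_def algebra_simps mult_le_0_iff intro: order_trans)

lemma check_loss_nonneg: "0 < \<tau> \<Longrightarrow> \<tau> < 1 \<Longrightarrow> 0 \<le> check_loss \<tau> u"
  by (cases "u \<le> 0") (auto simp: check_loss_def indicator_def mult_nonpos_nonpos)

lemma check_loss_convex: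
  assumes "0 < \<tau>" "\<tau> < 1" "0 \<le> t" "t \<le> 1"
  shows "check_loss \<tau> ((1 - t) * a + t * b) \<le> (1 - t) * check_loss \<tau> a + t * check_loss \<tau> b"
proof -
  have "s * ((1 - t) * a + t * b) \<le> (1 - t) * check_loss \<tau> a + t * check_loss \<tau> b" if "s \<in> {\<tau>, \<tau> - 1}" for s
  proof -
    have "s * a \<le> check_loss \<tau> a" "s * b \<le> check_loss \<tau> b"
      using that assms by (auto simp: check_loss_eq_max)
    then have "(1 - t) * (s * a) + t * (s * b) \<le> (1 - t) * check_loss \<tau> a + t * check_loss \<tau> b"
      using assms by (intro add_mono mult_left_mono) auto
    then show ?thesis by (simp add: algebra_simps)
  qed
  from this[of \<tau>] this[of "\<tau> - 1"] show ?thesis using assms by (simp add: check_loss_eq_max[of \<tau> "(1 - t) * a + t * b"])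
qed

lemma check_loss_measurable [measurable]: "check_loss \<tau> \<in> borel_measurable borel"
  unfolding check_loss_def[abs_def] by measurable

text \<open>The Jacobian of \<open>\<beta> = \<beta>0 + h / sqrt n\<close> and the factors of the
  likelihood free of \<open>h\<close> have already cancelled.\<close>

definition (in quantile_model) rescaled_posterior :: "(real^'p \<Rightarrow> real) \<Rightarrow> nat \<Rightarrow> 'a \<Rightarrow> real^'p \<Rightarrow> real" where
  "rescaled_posterior prior n \<omega> h = exp (- excess_loss n \<omega> h) * prior (\<beta>0 + (1 / sqrt (real n)) *\<^sub>R h)
     / (\<integral>h. exp (- excess_loss n \<omega> h) * prior (\<beta>0 + (1 / sqrt (real n)) *\<^sub>R h) \<partial>lborel)"

context quantile_model
begin

lemma convex_excess_loss: "convex_on UNIV (excess_loss n \<omega>)"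
proof (rule convex_onI)
  fix t :: real and x y :: "real^'p" assume t: "0 < t" "t < 1"
  let ?s = "1 / sqrt (real n)"
  have convex_comb: "b - z \<bullet> (\<beta>0 + s *\<^sub>R ((1 - t) *\<^sub>R x + t *\<^sub>R y)) = (1 - t) * (b - z \<bullet> (\<beta>0 + s *\<^sub>R x)) + t * (b - z \<bullet> (\<beta>0 + s *\<^sub>R y))" for b s z
    by (simp add: inner_add_right algebra_simps)
  let ?u = "\<lambda>i x. Y i \<omega> - X i \<bullet> (\<beta>0 + ?s *\<^sub>R x)"
  have u: "?u i ((1 - t) *\<^sub>R x + t *\<^sub>R y) = (1 - t) * ?u i x + t * ?u i y" for i
    using convex_comb[of "Y i \<omega>" "X i" "?s"] .
  have "excess_loss n \<omega> ((1 - t) *\<^sub>R x + t *\<^sub>R y)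
      \<le> (\<Sum>i=1..n. (1 - t) * (check_loss \<tau> (?u i x) - check_loss \<tau> (Y i \<omega> - X i \<bullet> \<beta>0))
          + t * (check_loss \<tau> (?u i y) - check_loss \<tau> (Y i \<omega> - X i \<bullet> \<beta>0)))"
    unfolding excess_loss_def
  proof (rule sum_mono)
    fix i
    have "check_loss \<tau> (?u i ((1 - t) *\<^sub>R x + t *\<^sub>R y)) \<le> (1 - t) * check_loss \<tau> (?u i x) + t * check_loss \<tau> (?u i y)"
      unfolding u by (rule check_loss_convex) (use tau t in auto)
    then show "check_loss \<tau> (?u i ((1 - t) *\<^sub>R x + t *\<^sub>R y)) - check_loss \<tau> (Y i \<omega> - X i \<bullet> \<beta>0)
        \<le> (1 - t) * (check_loss \<tau> (?u i x) - check_loss \<tau> (Y i \<omega> - X i \<bullet> \<beta>0))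
          + t * (check_loss \<tau> (?u i y) - check_loss \<tau> (Y i \<omega> - X i \<bullet> \<beta>0))"
      by (simp add: right_diff_distrib left_diff_distrib)
  qed
  also have "\<dots> = (1 - t) * excess_loss n \<omega> x + t * excess_loss n \<omega> y"
    by (simp add: excess_loss_def sum.distrib sum_distrib_left)
  finally show "excess_loss n \<omega> ((1 - t) *\<^sub>R x + t *\<^sub>R y) \<le> (1 - t) * excess_loss n \<omega> x + t * excess_loss n \<omega> y" .
qed simp

lemma excess_loss_measurable: "excess_loss n \<omega> \<in> borel_measurable borel"
  by (rule borel_measurable_continuous_onI, rule convex_on_continuous[OF open_UNIV convex_excess_loss])

lemma continuous_excess_loss: "continuous_on UNIV (excess_loss n \<omega>)"
  by (rule convex_on_continuous[OF open_UNIV convex_excess_loss])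

text \<open>Joint measurability in outcome and parameter allows integrating out the parameter and
  keeping a random variable.\<close>

lemma excess_loss_measurable2:
  "(\<lambda>x. excess_loss n (fst x) (snd x)) \<in> borel_measurable (M \<Otimes>\<^sub>M borel)"
  unfolding excess_loss_def
proof (rule borel_measurable_sum)
  fix i assume "i \<in> {1..n}"
  then have [measurable]: "Y i \<in> borel_measurable M" using Y_measurable by simp
  show "(\<lambda>x. check_loss \<tau> (Y i (fst x) - X i \<bullet> (\<beta>0 + (1 / sqrt (real n)) *\<^sub>R snd x)) - check_loss \<tau> (Y i (fst x) - X i \<bullet> \<beta>0))
      \<in> borel_measurable (M \<Otimes>\<^sub>M borel)"
    by measurable
qed

lemma ald_likelihood_eq:
  "ald_likelihood \<tau> X n (\<lambda>i. Y i \<omega>) (\<beta>0 + (1 / sqrt (real n)) *\<^sub>R h)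
    = (\<tau> * (1 - \<tau>)) ^ n * exp (- (\<Sum>i=1..n. check_loss \<tau> (Y i \<omega> - X i \<bullet> \<beta>0))) * exp (- excess_loss n \<omega> h)"
proof -
  let ?a = "\<lambda>i. check_loss \<tau> (Y i \<omega> - X i \<bullet> (\<beta>0 + (1 / sqrt (real n)) *\<^sub>R h))"
  have "(\<Sum>i=1..n. - ?a i) = - (\<Sum>i=1..n. check_loss \<tau> (Y i \<omega> - X i \<bullet> \<beta>0)) + - excess_loss n \<omega> h"
    by (simp add: excess_loss_def sum_subtractf sum_negf)
  moreover have "ald_likelihood \<tau> X n (\<lambda>i. Y i \<omega>) (\<beta>0 + (1 / sqrt (real n)) *\<^sub>R h) = (\<tau> * (1 - \<tau>)) ^ n * exp (\<Sum>i=1..n. - ?a i)"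
    unfolding ald_likelihood_def ald_density_def prod.distrib by (subst exp_sum) (simp_all add: power_mult_distrib)
  ultimately show ?thesis by (simp only: exp_add mult.assoc)
qed

lemma ald_likelihood_measurable: "ald_likelihood \<tau> X n y \<in> borel_measurable borel"
  unfolding ald_likelihood_def[abs_def] ald_density_def by measurable

text \<open>The check loss is nonnegative, so \<open>exp (- excess_loss n \<omega> h)\<close> is
  bounded in \<open>h\<close> and an integrable prior makes the kernel integrable.\<close>

lemma rescaled_posterior_props:
  fixes prior :: "real^'p \<Rightarrow> real"
  assumes n: "n \<ge> 1" and prior: "\<And>b. 0 \<le> prior b" "integrable lborel prior" "continuous_on UNIV prior" "prior \<beta>0 > 0"
  shows "integrable lborel (rescaled_posterior prior n \<omega>)"
    and "(\<integral>h. rescaled_posterior prior n \<omega> h \<partial>lborel) = 1"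
    and "B \<in> sets borel \<Longrightarrow> posterior \<tau> X prior n (\<lambda>i. Y i \<omega>) {\<beta>. sqrt (real n) *\<^sub>R (\<beta> - \<beta>0) \<in> B}
      = (LINT h:B|lborel. rescaled_posterior prior n \<omega> h)"
proof -
  let ?c = "1 / sqrt (real n)"
  have c: "?c \<noteq> 0" "?c > 0" using n by auto
  have [measurable]: "prior \<in> borel_measurable borel" using prior(3) by (rule borel_measurable_continuous_onI)
  note [measurable] = excess_loss_measurable ald_likelihood_measurable
  define f where "f h = exp (- excess_loss n \<omega> h) * prior (\<beta>0 + ?c *\<^sub>R h)" for h
  have f0: "0 \<le> f h" for h using prior(1) by (simp add: f_def)
  have [measurable]: "f \<in> borel_measurable borel" unfolding f_def[abs_def] by measurable
  define L where "L = (\<Sum>i=1..n. check_loss \<tau> (Y i \<omega> - X i \<bullet> \<beta>0))"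
  have lossb: "- excess_loss n \<omega> h \<le> L" for h
    unfolding excess_loss_def L_def sum_negf[symmetric] using check_loss_nonneg[OF tau] by (intro sum_mono) simp
  have pint: "integrable lborel (\<lambda>h. prior (\<beta>0 + ?c *\<^sub>R h))"
    by (rule integral_lborel_scale_translate(2)[OF _ c(1) prior(2)]) simp
  have fint: "integrable lborel f"
  proof (rule Bochner_Integration.integrable_bound)
    show "integrable lborel (\<lambda>h. exp L * prior (\<beta>0 + ?c *\<^sub>R h))" using pint by simp
    show "AE h in lborel. norm (f h) \<le> norm (exp L * prior (\<beta>0 + ?c *\<^sub>R h))"
      using lossb prior(1) by (intro AE_I2) (auto simp: f_def abs_mult intro!: mult_right_mono)
  qed simp
  have "continuous_on UNIV f"
    unfolding f_def[abs_def]
    by (intro continuous_intros continuous_excess_loss continuous_on_compose2[OF prior(3)]) auto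
  \<comment> \<open>A continuous function that vanishes almost everywhere vanishes everywhere,
    whereas \<open>f 0 = prior \<beta>0 > 0\<close>; hence the normaliser is positive.\<close>
  then have cl: "closed {h. f h = 0}" by (intro closed_Collect_eq continuous_on_const)
  have "(\<integral>h. f h \<partial>lborel) \<noteq> 0"
  proof
    assume "(\<integral>h. f h \<partial>lborel) = 0"
    then have "AE h in lborel. f h = 0"
      using integral_nonneg_eq_0_iff_AE[OF fint] f0 by simp
    then have "(0::real^'p) \<in> {h. f h = 0}"
      by (intro mem_closed_if_AE_lebesgue[OF cl]) (auto intro!: AE_completion)
    then show False using prior(4) by (simp add: f_def)
  qed
  moreover have "0 \<le> (\<integral>h. f h \<partial>lborel)" using f0 by (intro Bochner_Integration.integral_nonneg)
  ultimately have A: "(\<integral>h. f h \<partial>lborel) > 0" by linarith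
  have r: "rescaled_posterior prior n \<omega> h = f h / (\<integral>h. f h \<partial>lborel)" for h
    by (simp add: rescaled_posterior_def f_def)
  show "integrable lborel (rescaled_posterior prior n \<omega>)" unfolding r[abs_def] using fint by simp
  show "(\<integral>h. rescaled_posterior prior n \<omega> h \<partial>lborel) = 1" unfolding r using A by simp
  assume B[measurable]: "B \<in> sets borel"
  define k where "k = \<bar>?c\<bar> ^ DIM(real^'p) * ((\<tau> * (1 - \<tau>)) ^ n * exp (- L))"
  have k: "k \<noteq> 0" unfolding k_def using c tau by simp
  let ?S = "{\<beta>. sqrt (real n) *\<^sub>R (\<beta> - \<beta>0) \<in> B}"
  have [measurable]: "?S \<in> sets borel"
    using measurable_sets[of "\<lambda>\<beta>. sqrt (real n) *\<^sub>R (\<beta> - \<beta>0)" borel borel B] B by (simp add: vimage_def)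
  \<comment> \<open>The set \<open>S\<close> is left general so that the same identity gives the
    numerator and, with \<open>S = UNIV\<close>, the denominator; \<open>k\<close> then
    cancels.\<close>
  have int: "(\<integral>\<beta>. indicator S \<beta> *\<^sub>R (ald_likelihood \<tau> X n (\<lambda>i. Y i \<omega>) \<beta> * prior \<beta>) \<partial>lborel)
      = k * (\<integral>h. indicator S (\<beta>0 + ?c *\<^sub>R h) *\<^sub>R f h \<partial>lborel)" if [measurable]: "S \<in> sets borel" for S
  proof -
    have "(\<integral>\<beta>. indicator S \<beta> *\<^sub>R (ald_likelihood \<tau> X n (\<lambda>i. Y i \<omega>) \<beta> * prior \<beta>) \<partial>lborel)
        = \<bar>?c\<bar> ^ DIM(real^'p) * (\<integral>h. indicator S (\<beta>0 + ?c *\<^sub>R h) *\<^sub>R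
            (ald_likelihood \<tau> X n (\<lambda>i. Y i \<omega>) (\<beta>0 + ?c *\<^sub>R h) * prior (\<beta>0 + ?c *\<^sub>R h)) \<partial>lborel)"
      by (rule integral_lborel_scale_translate(1)[OF _ c(1)]) measurable
    also have "(\<lambda>h. indicator S (\<beta>0 + ?c *\<^sub>R h) *\<^sub>R
            (ald_likelihood \<tau> X n (\<lambda>i. Y i \<omega>) (\<beta>0 + ?c *\<^sub>R h) * prior (\<beta>0 + ?c *\<^sub>R h)))
        = (\<lambda>h. ((\<tau> * (1 - \<tau>)) ^ n * exp (- L)) * (indicator S (\<beta>0 + ?c *\<^sub>R h) *\<^sub>R f h))"
      unfolding ald_likelihood_eq f_def L_def[symmetric] by (simp add: mult_ac)
    also have "\<bar>?c\<bar> ^ DIM(real^'p) * (\<integral>h. ((\<tau> * (1 - \<tau>)) ^ n * exp (- L)) * (indicator S (\<beta>0 + ?c *\<^sub>R h) *\<^sub>R f h) \<partial>lborel)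
        = k * (\<integral>h. indicator S (\<beta>0 + ?c *\<^sub>R h) *\<^sub>R f h \<partial>lborel)"
      unfolding k_def by (subst integral_mult_right_zero) (simp only: mult.assoc)
    finally show ?thesis .
  qed
  have S: "(\<beta>0 + ?c *\<^sub>R h \<in> ?S) = (h \<in> B)" for h using n by simp
  have "posterior \<tau> X prior n (\<lambda>i. Y i \<omega>) ?S
      = (k * (\<integral>h. indicator B h *\<^sub>R f h \<partial>lborel)) / (k * (\<integral>h. f h \<partial>lborel))"
    unfolding posterior_def set_lebesgue_integral_def
    using int[of ?S] int[of UNIV] S by (simp add: indicator_def)
  also have "\<dots> = (\<integral>h. indicator B h *\<^sub>R f h \<partial>lborel) / (\<integral>h. f h \<partial>lborel)" using k by simp
  also have "\<dots> = (LINT h:B|lborel. rescaled_posterior prior n \<omega> h)"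
    unfolding r set_lebesgue_integral_def by simp
  finally show "posterior \<tau> X prior n (\<lambda>i. Y i \<omega>) ?S = (LINT h:B|lborel. rescaled_posterior prior n \<omega> h)" .
qed

lemma rescaled_posterior_measurable2:
  assumes [measurable]: "prior \<in> borel_measurable borel"
  shows "(\<lambda>x. rescaled_posterior prior n (fst x) (snd x)) \<in> borel_measurable (M \<Otimes>\<^sub>M borel)"
proof -
  note [measurable] = excess_loss_measurable2
  have num: "(\<lambda>x. exp (- excess_loss n (fst x) (snd x)) * prior (\<beta>0 + (1 / sqrt (real n)) *\<^sub>R snd x)) \<in> borel_measurable (M \<Otimes>\<^sub>M borel)"
    by measurable
  have "(\<lambda>\<omega>. \<integral>h. exp (- excess_loss n \<omega> h) * prior (\<beta>0 + (1 / sqrt (real n)) *\<^sub>R h) \<partial>lborel) \<in> borel_measurable M"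
    by (rule sigma_finite_measure.borel_measurable_lebesgue_integral[OF sigma_finite_lborel])
      (use num in \<open>simp add: case_prod_beta' cong: measurable_cong_sets\<close>)
  from measurable_compose[OF measurable_fst this] show ?thesis
    unfolding rescaled_posterior_def by (intro borel_measurable_divide num)
qed

end

section \<open>Total variation distance to the normal law, in probability\<close>

context quantile_model
begin

lemma SUP_posterior_mvn_diff:
  assumes n: "n \<ge> 1" and V: "pos_def V \<kappa>"
    and prior: "\<And>b. 0 \<le> prior b" "integrable lborel prior" "continuous_on UNIV prior" "prior \<beta>0 > 0"
  shows "(SUP B \<in> sets borel. \<bar>posterior \<tau> X prior n (\<lambda>i. Y i \<omega>) {\<beta>. sqrt (real n) *\<^sub>R (\<beta> - \<beta>0) \<in> B}
        - mvn_prob B \<mu> (matrix_inv V)\<bar>)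
    = (\<integral>h. \<bar>rescaled_posterior prior n \<omega> h - mvn_density \<mu> (matrix_inv V) h\<bar> \<partial>lborel) / 2"
proof -
  interpret pd: pos_def V \<kappa> by (rule V)
  note mvn = pd.inv pd.sym pd.pos
  note post = rescaled_posterior_props[OF n prior]
  have int: "(\<integral>h. mvn_density \<mu> (matrix_inv V) h \<partial>lborel) = 1"
    by (rule mvn_density_integral) (rule mvn, assumption?)+
  have intg: "integrable lborel (mvn_density \<mu> (matrix_inv V))"
    by (rule mvn_density_integrable) (rule mvn, assumption?)+
  have prob: "mvn_prob B \<mu> (matrix_inv V) = (LINT x:B|lborel. mvn_density \<mu> (matrix_inv V) x)" if "B \<in> sets borel" for B
    by (rule mvn_prob_eq[OF _ _ _ that]) (rule mvn, assumption?)+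
  show ?thesis
    using SUP_set_integral_diff[OF post(1) intg, of \<omega>] post(2)[of \<omega>] int
    by (simp add: post(3) prob cong: SUP_cong)
qed

text \<open>The centre \<open>b\<close> is random because the normal law is placed at the
  estimator.\<close>

lemma posterior_mvn_L1_measurable:
  assumes prior: "prior \<in> borel_measurable borel" and inv: "invertible V" and b: "b \<in> borel_measurable M"
  shows "(\<lambda>\<omega>. (\<integral>h. \<bar>rescaled_posterior prior n \<omega> h - mvn_density (b \<omega>) (matrix_inv V) h\<bar> \<partial>lborel) / 2) \<in> borel_measurable M"
proof -
  note [measurable] = rescaled_posterior_measurable2[OF prior] b
  have u: "(\<lambda>x. snd x - b (fst x)) \<in> borel_measurable (M \<Otimes>\<^sub>M borel)" by measurable
  have [measurable]: "(\<lambda>x. mvn_density (b (fst x)) (matrix_inv V) (snd x)) \<in> borel_measurable (M \<Otimes>\<^sub>M borel)"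
    unfolding mvn_density_inv_eq[OF inv]
    using measurable_compose[OF u measurable_quadratic[of V]] by measurable
  have "(\<lambda>x. \<bar>rescaled_posterior prior n (fst x) (snd x) - mvn_density (b (fst x)) (matrix_inv V) (snd x)\<bar>) \<in> borel_measurable (M \<Otimes>\<^sub>M borel)"
    by measurable
  then have "(\<lambda>\<omega>. \<integral>h. \<bar>rescaled_posterior prior n \<omega> h - mvn_density (b \<omega>) (matrix_inv V) h\<bar> \<partial>lborel) \<in> borel_measurable M"
    by (intro sigma_finite_measure.borel_measurable_lebesgue_integral[OF sigma_finite_lborel])
      (simp add: case_prod_beta' cong: measurable_cong_sets)
  then show ?thesis by (intro borel_measurable_divide) auto
qed

text \<open>Each constant depends only on earlier ones: tightness fixes \<open>R1\<close> with
  failure probability \<open>r / 2\<close>, the deterministic comparison then fixes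
  \<open>\<delta>\<close>, \<open>N\<close> and \<open>R\<close>, and convexity fixes
  \<open>H\<close> and \<open>d'\<close>. For large \<open>n\<close> the remainder fails somewhere
  on \<open>H\<close> with probability below the other \<open>r / 2\<close>.\<close>

lemma posterior_mvn_L1_tendsto_in_prob:
  fixes x :: "nat \<Rightarrow> 'a \<Rightarrow> real^'p"
  assumes V: "pos_def V \<kappa>"
    and prior: "\<And>b. 0 \<le> prior b" "bounded (range prior)" "continuous_on UNIV prior" "prior \<beta>0 > 0"
    and min: "\<And>n \<omega> h. n \<ge> 1 \<Longrightarrow> \<omega> \<in> space M \<Longrightarrow> excess_loss n \<omega> (x n \<omega>) \<le> excess_loss n \<omega> h"
    and \<epsilon>: "\<epsilon> > 0"
  shows "(\<lambda>n. prob {\<omega> \<in> space M. (\<integral>h. \<bar>rescaled_posterior prior n \<omega> h - mvn_density (x n \<omega>) (matrix_inv V) h\<bar> \<partial>lborel) \<ge> \<epsilon>})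
    \<longlonglongrightarrow> 0"
proof (rule tendstoI)
  interpret pd: pos_def V \<kappa> by (rule V)
  let ?L = "\<lambda>n \<omega>. \<integral>h. \<bar>rescaled_posterior prior n \<omega> h - mvn_density (x n \<omega>) (matrix_inv V) h\<bar> \<partial>lborel"
  fix r :: real assume r: "r > 0"
  obtain R1 where R1: "\<And>n. prob {\<omega> \<in> space M. norm (score n \<omega>) > R1} \<le> r / 2"
    using score_tight[of "r / 2"] r by auto
  from pd.posterior_L1_uniform[where K=R1, OF prior \<epsilon>] obtain \<delta> N R where \<delta>: "\<delta> > 0" and
    L: "\<forall>n D W x. n \<ge> N \<and> convex_on UNIV D \<and> norm W \<le> R1 \<and>
      (\<forall>h. norm h \<le> R \<longrightarrow> \<bar>D h + W \<bullet> h - pd.q h\<bar> \<le> \<delta>) \<and> (\<forall>h. D x \<le> D h) \<longrightarrow>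
      (\<integral>h. \<bar>pd.post_density D (\<lambda>h. prior (\<beta>0 + (1 / sqrt (real n)) *\<^sub>R h)) h - pd.normal_dens x h\<bar> \<partial>lborel) < \<epsilon>"
    by (elim exE conjE)
  from convex_near_on_finite_imp_near_on_ball[OF pd.continuous_q \<delta>, of R]
  obtain H d' where H: "finite H" and d': "d' > 0"
    and close: "\<forall>g. convex_on UNIV g \<and> (\<forall>h\<in>H. \<bar>g h - pd.q h\<bar> \<le> d') \<longrightarrow> (\<forall>h. norm h \<le> R \<longrightarrow> \<bar>g h - pd.q h\<bar> \<le> \<delta>)"
    by (elim exE conjE)
  let ?bad = "\<lambda>n h. {\<omega> \<in> space M. \<bar>remainder n h \<omega> - h \<bullet> (V *v h) / 2\<bar> > d'}"
  have "(\<lambda>n. \<Sum>h\<in>H. prob (?bad n h)) \<longlonglongrightarrow> (\<Sum>h\<in>H. 0)"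
    by (intro tendsto_sum remainder_tendsto_in_prob d')
  then have "\<forall>\<^sub>F n in sequentially. (\<Sum>h\<in>H. prob (?bad n h)) < r / 2"
    by (rule order_tendstoD(2)) (use r in simp)
  then show "\<forall>\<^sub>F n in sequentially. dist (prob {\<omega> \<in> space M. ?L n \<omega> \<ge> \<epsilon>}) 0 < r"
    using eventually_ge_at_top[of N] eventually_ge_at_top[of 1]
  proof eventually_elim
    case (elim n)
    note [measurable] = score_measurable remainder_measurable
    have sub: "{\<omega> \<in> space M. ?L n \<omega> \<ge> \<epsilon>} \<subseteq> {\<omega> \<in> space M. norm (score n \<omega>) > R1} \<union> (\<Union>h\<in>H. ?bad n h)"
    proof (rule ccontr)
      assume "\<not> ?thesis"
      then obtain \<omega> where \<omega>: "\<omega> \<in> space M" "?L n \<omega> \<ge> \<epsilon>" "norm (score n \<omega>) \<le> R1"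
        "\<forall>h\<in>H. \<bar>remainder n h \<omega> - h \<bullet> (V *v h) / 2\<bar> \<le> d'"
        by (auto simp: subset_iff not_less)
      have "convex_on UNIV (\<lambda>h. score n \<omega> \<bullet> h)"
        by (rule convex_onI) (auto simp: inner_add_right)
      then have cv: "convex_on UNIV (\<lambda>h. excess_loss n \<omega> h + score n \<omega> \<bullet> h)"
        by (intro convex_on_add convex_excess_loss)
      have "\<bar>excess_loss n \<omega> h + score n \<omega> \<bullet> h - pd.q h\<bar> \<le> \<delta>" if "norm h \<le> R" for h
        using close[rule_format, OF conjI[OF cv] that] \<omega>(4) by (simp add: excess_loss_eq pd.q_def)
      then have "?L n \<omega> < \<epsilon>"
        unfolding rescaled_posterior_def
        by (intro L[rule_format] conjI allI impI convex_excess_loss min[OF elim(3) \<omega>(1)])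
          (use \<omega>(3) elim(2) in auto)
      then show False using \<omega>(2) by simp
    qed
    have ev: "{\<omega> \<in> space M. norm (score n \<omega>) > R1} \<in> events" "\<And>h. ?bad n h \<in> events"
      by measurable
    then have evU: "(\<Union>h\<in>H. ?bad n h) \<in> events" using H by (intro sets.finite_UN)
    have "prob {\<omega> \<in> space M. ?L n \<omega> \<ge> \<epsilon>} \<le> prob ({\<omega> \<in> space M. norm (score n \<omega>) > R1} \<union> (\<Union>h\<in>H. ?bad n h))"
      using sub by (rule finite_measure_mono) (intro sets.Un ev evU)
    also have "\<dots> \<le> prob {\<omega> \<in> space M. norm (score n \<omega>) > R1} + prob (\<Union>h\<in>H. ?bad n h)"
      by (intro measure_Un_le ev evU)
    also have "prob (\<Union>h\<in>H. ?bad n h) \<le> (\<Sum>h\<in>H. prob (?bad n h))"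
      using H ev by (intro finite_measure_subadditive_finite) auto
    finally show ?case using R1[of n] elim(1) by (simp add: dist_real_def)
  qed
qed

end

section \<open>The Bernstein-von Mises theorem\<close>

theorem theorem1:
  fixes M :: "'a measure"
    and Y Z :: "nat \<Rightarrow> 'a \<Rightarrow> real"
    and p :: "nat \<Rightarrow> real \<Rightarrow> real"
    and X :: "nat \<Rightarrow> real ^ 'p"
    and \<beta>0 :: "real ^ 'p"
    and k1 :: 'p
    and \<tau> :: real
    and prior :: "real ^ 'p \<Rightarrow> real"
    and V :: "real ^ 'p ^ 'p"
    and \<beta>M :: "nat \<Rightarrow> 'a \<Rightarrow> real ^ 'p"
  assumes tau: "0 < \<tau>" "\<tau> < 1"
    and prob: "prob_space M"
    and indep: "prob_space.indep_vars M (\<lambda>_. borel) Y {1..}"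
    and p_nonneg: "\<And>i y. i \<ge> 1 \<Longrightarrow> 0 \<le> p i y"
    and pdf: "\<And>i. i \<ge> 1 \<Longrightarrow> distributed M lborel (Y i) (\<lambda>y. ennreal (p i y))"
    and Z_def: "\<And>i \<omega>. Z i \<omega> = Y i \<omega> - X i \<bullet> \<beta>0"
    and quantile: "\<And>i. i \<ge> 1 \<Longrightarrow> measure M {\<omega> \<in> space M. Z i \<omega> \<le> 0} = \<tau>"
    and V_lim: "(\<lambda>n. (1 / real n) *\<^sub>R (\<Sum>i=1..n. p i (X i \<bullet> \<beta>0) *\<^sub>R outer_square (X i)))
                  \<longlonglongrightarrow> V"
    and V_inv: "invertible V"
    and \<beta>M_meas: "\<And>n. \<beta>M n \<in> borel_measurable M"
    and \<beta>M_argmin: "\<And>n \<omega>. \<omega> \<in> space M \<Longrightarrow>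
          is_arg_min (\<lambda>\<beta>. \<Sum>i=1..n. check_loss \<tau> (Y i \<omega> - X i \<bullet> \<beta>)) (\<lambda>_. True) (\<beta>M n \<omega>)"
    and A1_pdf: "\<And>\<beta>. 0 \<le> prior \<beta>" "prob_space (density lborel (\<lambda>\<beta>. ennreal (prior \<beta>)))"
    and A1a: "bounded (range prior)" "continuous_on UNIV prior" "prior \<beta>0 > 0"
    and A1b: "integrable lborel (\<lambda>\<beta>. (norm \<beta>)\<^sup>2 * prior \<beta>)"
    and A2: "\<exists>K>0. \<forall>i\<ge>1. norm (X i) \<le> K"
    and A3a: "\<forall>i\<ge>1. X i $ k1 = 1"
      "\<exists>c. c $ k1 = 0 \<and>
         (\<exists>\<epsilon>0>0. \<forall>D\<in>spread_sets k1 \<epsilon>0.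
            liminf (\<lambda>n. ereal ((\<Sum>i=1..n. indicator D (X i - c)) / real n)) > 0)"
    and A3b: "\<exists>C>0. \<forall>\<^sub>F \<Delta> in at_right 0. \<forall>i\<ge>1.
         measure M {\<omega> \<in> space M. 0 < Z i \<omega> \<and> Z i \<omega> < \<Delta>} > C * \<Delta> \<and>
         measure M {\<omega> \<in> space M. - \<Delta> < Z i \<omega> \<and> Z i \<omega> < 0} > C * \<Delta>"
    and A4: "\<forall>i\<ge>1. integrable M (\<lambda>\<omega>. (Z i \<omega>)\<^sup>2)"
      "limsup (\<lambda>m. ereal ((\<Sum>i=1..m. \<integral>\<omega>. \<bar>Z i \<omega>\<bar> \<partial>M) / real m)) < \<infinity>"
      "summable (\<lambda>i. (\<integral>\<omega>. (Z (Suc i) \<omega>)\<^sup>2 \<partial>M) / (real (Suc i))\<^sup>2)"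
    and A5a: "\<exists>K. \<forall>i\<ge>1. p i (X i \<bullet> \<beta>0) \<le> K"
    and A5b: "\<exists>C>0. \<exists>\<eta>>0. \<forall>\<^sub>F \<beta> in nhds \<beta>0. \<forall>i\<ge>1.
         \<bar>p i (X i \<bullet> \<beta>) - p i (X i \<bullet> \<beta>0)\<bar> \<le> C * \<bar>X i \<bullet> \<beta> - X i \<bullet> \<beta>0\<bar> powr \<eta>"
  shows "tendsto_in_prob M
    (\<lambda>n \<omega>. SUP B \<in> sets borel.
       \<bar>posterior \<tau> X prior n (\<lambda>i. Y i \<omega>) {\<beta>. sqrt (real n) *\<^sub>R (\<beta> - \<beta>0) \<in> B}
        - mvn_prob B (sqrt (real n) *\<^sub>R (\<beta>M n \<omega> - \<beta>0)) (matrix_inv V)\<bar>) 0"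
proof -
  obtain K where K: "\<And>i. i \<ge> 1 \<Longrightarrow> norm (X i) \<le> K" using A2 by blast
  obtain C \<eta> where C: "C > 0" and eta: "\<eta> > 0"
    and ev: "\<forall>\<^sub>F \<beta> in nhds \<beta>0. \<forall>i\<ge>1.
         \<bar>p i (X i \<bullet> \<beta>) - p i (X i \<bullet> \<beta>0)\<bar> \<le> C * \<bar>X i \<bullet> \<beta> - X i \<bullet> \<beta>0\<bar> powr \<eta>"
    using A5b by blast
  obtain e where e: "e > 0" and hoelder: "\<And>\<beta> i. dist \<beta> \<beta>0 < e \<Longrightarrow> i \<ge> 1 \<Longrightarrow>
         \<bar>p i (X i \<bullet> \<beta>) - p i (X i \<bullet> \<beta>0)\<bar> \<le> C * \<bar>X i \<bullet> \<beta> - X i \<bullet> \<beta>0\<bar> powr \<eta>"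
    using ev unfolding eventually_nhds_metric by blast
  \<comment> \<open>The locale admits \<open>\<bar>s\<bar>\<close> equal to its radius while the
    neighbourhood is an open ball of radius \<open>e\<close>; hence \<open>e / 2\<close>.\<close>
  interpret quantile_model M Y p X \<beta>0 \<tau> V K C "e / 2" \<eta>
  proof (intro quantile_model.intro quantile_model_axioms.intro prob tau indep p_nonneg pdf V_lim K eta)
    fix i :: nat and s :: real assume i: "1 \<le> i" and s: "\<bar>s\<bar> \<le> e / 2"
    \<comment> \<open>Moving \<open>\<beta>\<close> along the intercept shifts every \<open>X i \<bullet> \<beta>\<close> by the same amount, so A5(b) is a
      Hoelder condition on the densities that is uniform in \<open>i\<close>.\<close>
    have "dist (\<beta>0 + s *\<^sub>R axis k1 1) \<beta>0 < e" using s e by (simp add: dist_norm)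
    moreover have "X i \<bullet> (\<beta>0 + s *\<^sub>R axis k1 1) = X i \<bullet> \<beta>0 + s"
      using A3a(1) i by (simp add: inner_add_right inner_axis)
    ultimately show "\<bar>p i (X i \<bullet> \<beta>0 + s) - p i (X i \<bullet> \<beta>0)\<bar> \<le> C * \<bar>s\<bar> powr \<eta>"
      using hoelder[of "\<beta>0 + s *\<^sub>R axis k1 1" i] i by simp
  qed (use quantile Z_def C e in auto)
  obtain \<kappa> where V: "pos_def V \<kappa>"
    using positive_definite_limit[OF V_lim _ V_inv] p_nonneg by blast
  have prior_meas: "prior \<in> borel_measurable borel" using A1a(2) by (rule borel_measurable_continuous_onI)
  have "(\<integral>\<^sup>+ \<beta>. ennreal (prior \<beta>) \<partial>lborel) = 1"
    using prob_space.emeasure_space_1[OF A1_pdf(2)] prior_meas by (simp add: emeasure_density)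
  then have prior_int: "integrable lborel prior"
    using A1_pdf(1) prior_meas by (intro integrableI_nonneg) auto
  define x where "x n \<omega> = sqrt (real n) *\<^sub>R (\<beta>M n \<omega> - \<beta>0)" for n \<omega>
  define T where "T n \<omega> = (SUP B \<in> sets borel.
       \<bar>posterior \<tau> X prior n (\<lambda>i. Y i \<omega>) {\<beta>. sqrt (real n) *\<^sub>R (\<beta> - \<beta>0) \<in> B}
        - mvn_prob B (x n \<omega>) (matrix_inv V)\<bar>)" for n \<omega>
  let ?L = "\<lambda>n \<omega>. \<integral>h. \<bar>rescaled_posterior prior n \<omega> h - mvn_density (x n \<omega>) (matrix_inv V) h\<bar> \<partial>lborel"
  have T: "T n \<omega> = ?L n \<omega> / 2" if "n \<ge> 1" for n \<omega>
    unfolding T_def by (rule SUP_posterior_mvn_diff[OF that V A1_pdf(1) prior_int A1a(2,3)])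
  have x_meas: "x n \<in> borel_measurable M" for n
    unfolding x_def using \<beta>M_meas[of n] by measurable
  have T_meas: "T n \<in> borel_measurable M" for n
  proof (cases "n = 0")
    case True
    \<comment> \<open>The factor \<open>sqrt 0 = 0\<close> removes all dependence on \<open>\<omega>\<close>.\<close>
    have "T 0 \<omega> = T 0 \<omega>'" for \<omega> \<omega>'
      by (simp add: T_def x_def posterior_def ald_likelihood_def)
    then have "T 0 = (\<lambda>_. T 0 undefined)" by blast
    then show ?thesis using True by (metis borel_measurable_const)
  next
    case False
    then have "T n = (\<lambda>\<omega>. ?L n \<omega> / 2)" using T by force
    then show ?thesis using posterior_mvn_L1_measurable[OF prior_meas V_inv x_meas] by simp
  qed
  \<comment> \<open>The excess loss is the estimation criterion in the local parameter minus a
    constant, so the rescaled estimator minimises it; \<open>n \<ge> 1\<close> makes the rescaling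
    invertible.\<close>
  have min: "excess_loss n \<omega> (x n \<omega>) \<le> excess_loss n \<omega> h" if "n \<ge> 1" "\<omega> \<in> space M" for n \<omega> h
  proof -
    have "\<beta>0 + (1 / sqrt (real n)) *\<^sub>R x n \<omega> = \<beta>M n \<omega>" using that by (simp add: x_def)
    moreover have "(\<Sum>i=1..n. check_loss \<tau> (Y i \<omega> - X i \<bullet> \<beta>M n \<omega>)) \<le> (\<Sum>i=1..n. check_loss \<tau> (Y i \<omega> - X i \<bullet> \<beta>))" for \<beta>
      using \<beta>M_argmin[OF that(2), of n] by (auto simp: is_arg_min_def not_less)
    ultimately show ?thesis by (simp add: excess_loss_def sum_subtractf)
  qed
  have "(\<lambda>n. prob {\<omega> \<in> space M. \<bar>T n \<omega> - 0\<bar> > \<epsilon>}) \<longlonglongrightarrow> 0" if \<epsilon>: "\<epsilon> > 0" for \<epsilon>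
  proof (rule tendsto_sandwich[OF _ _ tendsto_const])
    \<comment> \<open>The supremum is half the L1 distance, so exceeding \<open>\<epsilon>\<close>
      means an L1 distance above \<open>2 * \<epsilon>\<close>.\<close>
    have "2 * \<epsilon> > 0" using \<epsilon> by simp
    from posterior_mvn_L1_tendsto_in_prob[OF V A1_pdf(1) A1a min this]
    show "(\<lambda>n. prob {\<omega> \<in> space M. ?L n \<omega> \<ge> 2 * \<epsilon>}) \<longlonglongrightarrow> 0" .
    show "\<forall>\<^sub>F n in sequentially. prob {\<omega> \<in> space M. \<bar>T n \<omega> - 0\<bar> > \<epsilon>} \<le> prob {\<omega> \<in> space M. ?L n \<omega> \<ge> 2 * \<epsilon>}"
      using eventually_ge_at_top[of 1]
    proof eventually_elim
      case (elim n)
      have Leq: "?L n \<omega> = 2 * T n \<omega>" for \<omega> using T[OF elim, of \<omega>] by linarith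
      have "0 \<le> ?L n \<omega>" for \<omega> by (rule Bochner_Integration.integral_nonneg) simp
      then have "T n \<omega> \<ge> 0" for \<omega> unfolding Leq by (metis mult_2 add_nonneg_eq_0_iff zero_le_double_add_iff_zero_le_single_add)
      then show ?case unfolding Leq
        using T_meas[of n] by (intro finite_measure_mono) auto
    qed
  qed simp
  then have "tendsto_in_prob M T 0" unfolding tendsto_in_prob_def using T_meas by blast
  then show ?thesis unfolding T_def[abs_def] x_def .
qed

end
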